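(* Let $\mathbb{P}$ be the unique Gibbs measure on $\Omega=\mathcal{A}^{\mathbb{Z}}$ with interaction $U\in\mathcal{U}$, and let $\alpha=p(U)-\frac{p(2U)}{2}$ (which is strictly positive). Let $M(\sigma,n)$ be the maximal length of a shift-matching up to $n$. Then $$\frac{M(\sigma,n)}{\log n}\to\frac1\alpha\qquad (n\to\infty),$$ where the convergence is in $\mathbb{P}$-probability.
   Context: $\mathcal{A}$ is a finite set with at least two elements; $\Omega=\mathcal{A}^{\mathbb{Z}}$ with the product topology and product sigma-field; $\mathcal{S}$ is the set of (nonempty) finite subsets of $\mathbb{Z}$; for $V\subseteq\mathbb{Z}$, $\sigma_V$ is the restriction of $\sigma\in\Omega$ to $V$, $\Omega_V=\mathcal{A}^V$, and $\mathcal{F}_V$ is the sigma-field generated by $\{\sigma(i):i\in V\}$. The shift is $(\tau_i\sigma)(j)=\sigma(i+j)$. $\operatorname{diam}(A)=\max\{|i-j|:i,j\in A\}$. $C_k=\{1,\dots,k\}$. Interactions: $\mathcal{U}$ is the set of maps $U:\mathcal{S}\times\Omega\to\mathbb{R}$ such that (i) $\sigma\mapsto U(A,\sigma)$ is $\mathcal{F}_A$-measurable for all $A\in\mathcal{S}$; (ii) $U(A+i,\tau_{-i}\sigma)=U(A,\sigma)$ for all $A\in\mathcal{S}$, $i\in\mathbb{Z}$, $\sigma\in\Omega$; (iii) there is $\gamma>0$ with $\sum_{A\ni 0}e^{\gamma\operatorname{diam}(A)}\sup_{\sigma\in\Omega}|U(A,\sigma)|<\infty$. For real $q$, $(qU)(A,\sigma)=q\,U(A,\sigma)$.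 Gibbs measures: for $\Lambda\in\mathcal{S}$, $\zeta\in\Omega$, put $H_\Lambda^\zeta(\sigma)=\sum_{A\cap\Lambda\ne\varnothing}U(A,\sigma_\Lambda\zeta_{\Lambda^c})$, where $\sigma_\Lambda\zeta_{\Lambda^c}$ equals $\sigma$ on $\Lambda$ and $\zeta$ off $\Lambda$. A probability measure $\mathbb{P}$ on $\Omega$ is a Gibbs measure with interaction $U$ if for all $\Lambda\in\mathcal{S}$ the conditional distribution of $\sigma_\Lambda$ given $\sigma_{\Lambda^c}=\zeta_{\Lambda^c}$ is, for $\mathbb{P}$-a.e. $\zeta$, given by the weights $e^{-H_\Lambda^\zeta(\sigma)}/\sum_{\sigma'_\Lambda\in\Omega_\Lambda}e^{-H_\Lambda^\zeta(\sigma')}$. For $U\in\mathcal{U}$ there is exactly one Gibbs measure with interaction $U$. Pressure: $p(U)=\lim_{n\to\infty}\frac1n\log\sum_{\sigma_{C_n}\in\Omega_{C_n}}\exp\bigl(-\sum_{A\subseteq C_n}U(A,\sigma)\bigr)$. Maximal shift-matching: $M(\sigma,n)$ is the maximal integer $k$ with $1\le k\le n$ such that there exist integers $0\le i<j\le n-k$ with $(\tau_i\sigma)_{C_k}=(\tau_j\sigma)_{C_k}$; $M(\sigma,n)=0$ if there is no such $k$. Here $\log$ is the natural logarithm. *)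

theory Defs
  imports "HOL-Probability.Probability"
begin

text \<open>The alphabet is a type \<open>'a\<close> of class \<open>finite\<close>, a configuration is a function
  \<open>int \<Rightarrow> 'a\<close>. The restriction of \<open>\<sigma>\<close> to \<open>V\<close> is \<open>restrict \<sigma> V\<close>, so that \<open>\<A>\<^sup>V\<close> is the set
  of extensional functions \<open>configs V\<close>.\<close>

definition finite_sets :: "int set set" where
  "finite_sets = {A. finite A \<and> A \<noteq> {}}"

definition configs :: "int set \<Rightarrow> (int \<Rightarrow> 'a) set" where
  "configs V = (\<Pi>\<^sub>E i\<in>V. UNIV)"

definition Omega :: "(int \<Rightarrow> 'a) measure" where
  "Omega = (\<Pi>\<^sub>M i\<in>UNIV. count_space UNIV)"

text \<open>Only the space and the measurable sets of \<open>coord_algebra V\<close> are relevant.\<close>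

definition coord_algebra :: "int set \<Rightarrow> (int \<Rightarrow> 'a) measure" where
  "coord_algebra V = sigma UNIV {(\<lambda>\<sigma>. \<sigma> i) -` B | i B. i \<in> V}"

definition shift :: "int \<Rightarrow> (int \<Rightarrow> 'a) \<Rightarrow> int \<Rightarrow> 'a" where
  "shift i \<sigma> = (\<lambda>j. \<sigma> (i + j))"

definition diam :: "int set \<Rightarrow> int" where
  "diam A = Max {\<bar>i - j\<bar> | i j. i \<in> A \<and> j \<in> A}"

definition block :: "nat \<Rightarrow> int set" where
  "block k = {1..int k}"

text \<open>An interaction is a function on all of \<open>int set\<close>, but its values outside \<open>finite_sets\<close>
  are never used. The real-valued supremum is harmless: measurability with respect to
  \<open>coord_algebra A\<close> means that \<open>U A \<sigma>\<close> depends only on the finitely many values of \<open>\<sigma>\<close> on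
  \<open>A\<close>, hence \<open>U A\<close> has finite range.\<close>

definition interactions :: "(int set \<Rightarrow> (int \<Rightarrow> 'a) \<Rightarrow> real) set" where
  "interactions = {U.
     (\<forall>A\<in>finite_sets. U A \<in> borel_measurable (coord_algebra A)) \<and>
     (\<forall>A\<in>finite_sets. \<forall>i \<sigma>. U ((\<lambda>j. j + i) ` A) (shift (- i) \<sigma>) = U A \<sigma>) \<and>
     (\<exists>\<gamma>>0. (\<lambda>A. exp (\<gamma> * real_of_int (diam A)) * (SUP \<sigma>. \<bar>U A \<sigma>\<bar>))
              summable_on {A \<in> finite_sets. 0 \<in> A})}"

definition scale_interaction ::
  "real \<Rightarrow> (int set \<Rightarrow> (int \<Rightarrow> 'a) \<Rightarrow> real) \<Rightarrow> int set \<Rightarrow> (int \<Rightarrow> 'a) \<Rightarrow> real" where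
  "scale_interaction q U = (\<lambda>A \<sigma>. q * U A \<sigma>)"

text \<open>For \<open>A \<subseteq> block n\<close> the value \<open>U A \<sigma>\<close> depends only on the restriction of \<open>\<sigma>\<close> to \<open>block n\<close>, so it
  may be evaluated at the extensional representative.\<close>

definition pressure :: "(int set \<Rightarrow> (int \<Rightarrow> 'a::finite) \<Rightarrow> real) \<Rightarrow> real" where
  "pressure U = lim (\<lambda>n. 1 / real n *
     ln (\<Sum>\<sigma>\<in>configs (block n). exp (- (\<Sum>A | A \<in> finite_sets \<and> A \<subseteq> block n. U A \<sigma>))))"

text \<open>\<open>override_on \<zeta> \<sigma> \<Lambda>\<close> equals \<open>\<sigma>\<close> on \<open>\<Lambda>\<close> and \<open>\<zeta>\<close> off \<open>\<Lambda>\<close>. For \<open>U \<in> interactions\<close> and finite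
  \<open>\<Lambda>\<close> the sum over all \<open>A\<close> meeting \<open>\<Lambda>\<close> converges absolutely.\<close>

definition Hamiltonian ::
  "(int set \<Rightarrow> (int \<Rightarrow> 'a) \<Rightarrow> real) \<Rightarrow> int set \<Rightarrow> (int \<Rightarrow> 'a) \<Rightarrow> (int \<Rightarrow> 'a) \<Rightarrow> real" where
  "Hamiltonian U \<Lambda> \<zeta> \<sigma> =
     (\<Sum>\<^sub>\<infinity>A\<in>{A \<in> finite_sets. A \<inter> \<Lambda> \<noteq> {}}. U A (override_on \<zeta> \<sigma> \<Lambda>))"

definition gibbs_measure ::
  "(int set \<Rightarrow> (int \<Rightarrow> 'a::finite) \<Rightarrow> real) \<Rightarrow> (int \<Rightarrow> 'a) measure \<Rightarrow> bool" where
  "gibbs_measure U P \<longleftrightarrow>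
     prob_space P \<and> sets P = sets Omega \<and>
     (\<forall>\<Lambda>\<in>finite_sets. AE \<zeta> in P. \<forall>\<xi>\<in>configs \<Lambda>.
        real_cond_exp P (coord_algebra (- \<Lambda>)) (indicator {\<sigma>. restrict \<sigma> \<Lambda> = \<xi>}) \<zeta> =
        exp (- Hamiltonian U \<Lambda> \<zeta> \<xi>) / (\<Sum>\<xi>'\<in>configs \<Lambda>. exp (- Hamiltonian U \<Lambda> \<zeta> \<xi>')))"

definition matching_lengths :: "(int \<Rightarrow> 'a) \<Rightarrow> nat \<Rightarrow> nat set" where
  "matching_lengths \<sigma> n = {k. 1 \<le> k \<and> k \<le> n \<and>
     (\<exists>i j. 0 \<le> i \<and> i < j \<and> j \<le> int n - int k \<and>
        restrict (shift i \<sigma>) (block k) = restrict (shift j \<sigma>) (block k))}"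

definition max_matching :: "(int \<Rightarrow> 'a) \<Rightarrow> nat \<Rightarrow> nat" where
  "max_matching \<sigma> n =
     (if matching_lengths \<sigma> n = {} then 0 else Max (matching_lengths \<sigma> n))"

definition tendsto_in_prob :: "'b measure \<Rightarrow> (nat \<Rightarrow> 'b \<Rightarrow> real) \<Rightarrow> real \<Rightarrow> bool" where
  "tendsto_in_prob P X c \<longleftrightarrow>
     (\<forall>\<epsilon>>0. (\<lambda>n. measure P {\<omega> \<in> space P. \<bar>X n \<omega> - c\<bar> > \<epsilon>}) \<longlonglongrightarrow> 0)"

end

theory Submission imports Defs "HOL-Real_Asymp.Real_Asymp" begin

text \<open>Exponential decay of the interaction bounds the energy of all sets crossing the boundary of
  an interval, uniformly in the interval. Hence, up to a constant factor, the probability of a word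
  given any event outside its window is its finite-volume weight. This quasi-product property
  replaces uniqueness, shift invariance and mixing. Up to constants the collision probability of
  two disjoint windows of length \<open>k\<close> is the sum of the squared weights, of order
  \<open>exp (- 2 \<alpha> k)\<close>, and overlapping windows match with probability at most of order
  \<open>exp (- \<alpha> k)\<close>. A union bound gives the upper estimate. For the lower one, the second
  moment method only yields a match with probability bounded below, but it does so, conditionally
  on everything else, in each of \<open>t\<close> disjoint stretches of length about \<open>n / t\<close>, so that no
  match at all has probability at most \<open>(1 - c) ^ t\<close>.\<close>

subsection \<open>Local events, interactions and boundary terms\<close>

text \<open>The quasi-product bounds carry a constant factor that does not improve with the distance
  between windows. The variance of the number of matches therefore need not be small against the
  squared mean; this is why the second moment method stops at a positive constant. The number
  \<open>t\<close> of stretches is fixed while \<open>n\<close> tends to infinity, and is made large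
  only afterwards. The crude bound for overlapping windows is good enough because there are only
  about \<open>n * k\<close> such pairs against \<open>n^2\<close> disjoint ones: for
  \<open>k\<close> at least \<beta> log n with \<beta> > 1/\<alpha>, both n^2 exp(- 2 \<alpha> k)
  and n k exp(- \<alpha> k) tend to 0. The value p(2U) enters because the square of a weight for U
  is, up to normalisation, a weight for 2U. Positivity of \<alpha> has a separate source: with at
  least two letters, no prescribed letter at a site has conditional probability close to 1, so word
  probabilities decay exponentially, and the collision probability with them.\<close>

definition depends_on :: "int set \<Rightarrow> (int \<Rightarrow> 'a) set \<Rightarrow> bool" where
  "depends_on V S \<longleftrightarrow> (\<forall>\<sigma> \<sigma>'. (\<forall>i\<in>V. \<sigma> i = \<sigma>' i) \<longrightarrow> (\<sigma> \<in> S \<longleftrightarrow> \<sigma>' \<in> S))"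

lemma depends_onD: "depends_on V S \<Longrightarrow> (\<And>i. i \<in> V \<Longrightarrow> \<sigma> i = \<sigma>' i) \<Longrightarrow> \<sigma> \<in> S \<longleftrightarrow> \<sigma>' \<in> S"
  by (auto simp: depends_on_def)

lemma depends_on_mono: "depends_on V S \<Longrightarrow> V \<subseteq> V' \<Longrightarrow> depends_on V' S"
  by (auto simp: depends_on_def subset_iff)

lemma depends_onI:
  fixes S :: "(int \<Rightarrow> 'a) set"
  assumes "\<And>\<sigma> \<sigma>'. (\<And>i. i \<in> V \<Longrightarrow> \<sigma> i = \<sigma>' i) \<Longrightarrow> \<sigma> \<in> S \<Longrightarrow> \<sigma>' \<in> S"
  shows "depends_on V S"
  unfolding depends_on_def
proof (intro allI impI iffI)
  fix \<sigma> \<sigma>' :: "int \<Rightarrow> 'a" assume eq: "\<forall>i\<in>V. \<sigma> i = \<sigma>' i"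
  show "\<sigma>' \<in> S" if "\<sigma> \<in> S" using that eq by (intro assms[of \<sigma> \<sigma>']) auto
  show "\<sigma> \<in> S" if "\<sigma>' \<in> S" using that eq by (intro assms[of \<sigma>' \<sigma>]) auto
qed

lemma depends_on_Int:
  assumes "depends_on V S" "depends_on V T" shows "depends_on V (S \<inter> T)"
proof (rule depends_onI)
  fix \<sigma> \<sigma>' assume "\<And>i. i \<in> V \<Longrightarrow> \<sigma> i = \<sigma>' i" "\<sigma> \<in> S \<inter> T"
  then show "\<sigma>' \<in> S \<inter> T"
    using depends_onD[OF assms(1), of \<sigma> \<sigma>'] depends_onD[OF assms(2), of \<sigma> \<sigma>'] by blast
qed

lemma depends_on_Compl: "depends_on V S \<Longrightarrow> depends_on V (- S)"
  by (simp add: depends_on_def)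

lemma space_coord_algebra [simp]: "space (coord_algebra V) = UNIV"
  by (simp add: coord_algebra_def)

lemma sets_coord_algebra: "sets (coord_algebra V) = sigma_sets UNIV {(\<lambda>\<sigma>. \<sigma> i) -` B | i B. i \<in> V}"
  by (simp add: coord_algebra_def)

lemma space_Omega [simp]: "space Omega = UNIV"
  by (simp add: Omega_def space_PiM PiE_UNIV_domain)

lemma sets_coord_algebra_subset: "sets (coord_algebra V) \<subseteq> sets (Omega :: (int \<Rightarrow> 'a) measure)"
proof -
  have "(\<lambda>\<sigma>. \<sigma> i) -` B \<in> sets (Omega :: (int \<Rightarrow> 'a) measure)" for i and B :: "'a set"
  proof -
    have "(\<lambda>\<sigma>. \<sigma> i) \<in> measurable (Omega :: (int \<Rightarrow> 'a) measure) (count_space UNIV)"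
      unfolding Omega_def by (rule measurable_component_singleton) simp
    from measurable_sets[OF this, of B] show ?thesis by simp
  qed
  then have "{(\<lambda>\<sigma>. \<sigma> i) -` B | i B. i \<in> V} \<subseteq> sets (Omega :: (int \<Rightarrow> 'a) measure)" by auto
  from sets.sigma_sets_subset[OF this] show ?thesis by (simp add: sets_coord_algebra)
qed

lemma depends_on_coord_algebra:
  assumes "S \<in> sets (coord_algebra V)" shows "depends_on V S"
proof -
  from assms have "S \<in> sigma_sets UNIV {(\<lambda>\<sigma>. \<sigma> i) -` B | i B. i \<in> V}"
    by (simp add: sets_coord_algebra)
  then show ?thesis
  proof (induction rule: sigma_sets.induct)
    case (Compl S)
    then show ?case by (simp add: depends_on_def)
  next
    case (Union S)
    show ?case
    proof (rule depends_onI)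
      fix \<sigma> \<sigma>' assume "\<And>i. i \<in> V \<Longrightarrow> \<sigma> i = \<sigma>' i" "\<sigma> \<in> (\<Union>n. S n)"
      then show "\<sigma>' \<in> (\<Union>n. S n)" using depends_onD[OF Union.IH] by blast
    qed
  qed (auto simp: depends_on_def)
qed

text \<open>Over a finite alphabet such an event is a finite union of cylinders on \<open>V\<close>.
  The larger set \<open>V'\<close> may be infinite; it will be the complement of a window, on which
  the Gibbs condition is imposed.\<close>

lemma coord_algebra_if_depends_on:
  fixes S :: "(int \<Rightarrow> 'a::finite) set"
  assumes "finite V" "depends_on V S" "V \<subseteq> V'" shows "S \<in> sets (coord_algebra V')"
proof -
  have meas: "{\<sigma>. \<forall>i\<in>V. \<sigma> i = \<eta> i} \<in> sets (coord_algebra V')" for \<eta> :: "int \<Rightarrow> 'a"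
  proof -
    have "(\<lambda>\<sigma>. \<sigma> i) -` {\<eta> i} \<in> sets (coord_algebra V')" if "i \<in> V" for i
      using that assms(3) by (auto simp: sets_coord_algebra intro!: sigma_sets.Basic)
    with \<open>finite V\<close> have "{\<sigma> \<in> space (coord_algebra V'). \<forall>i\<in>V. \<sigma> i = \<eta> i} \<in> sets (coord_algebra V')"
      by (intro sets.sets_Collect_finite_All) (auto simp: vimage_def)
    then show ?thesis by simp
  qed
  have fin: "finite ((\<lambda>\<sigma>. restrict \<sigma> V) ` S)"
    by (rule finite_subset[OF _ finite_PiE[OF \<open>finite V\<close>, of "\<lambda>_. UNIV"]]) auto
  have "S = (\<Union>\<eta>\<in>(\<lambda>\<sigma>. restrict \<sigma> V) ` S. {\<sigma>. \<forall>i\<in>V. \<sigma> i = \<eta> i})"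
  proof (intro equalityI subsetI)
    fix \<sigma> assume "\<sigma> \<in> (\<Union>\<eta>\<in>(\<lambda>\<sigma>. restrict \<sigma> V) ` S. {\<sigma>. \<forall>i\<in>V. \<sigma> i = \<eta> i})"
    then obtain \<sigma>' where "\<sigma>' \<in> S" "\<forall>i\<in>V. \<sigma> i = \<sigma>' i" by auto
    with depends_onD[OF assms(2), of \<sigma> \<sigma>'] show "\<sigma> \<in> S" by blast
  qed auto
  moreover have "(\<Union>\<eta>\<in>(\<lambda>\<sigma>. restrict \<sigma> V) ` S. {\<sigma>. \<forall>i\<in>V. \<sigma> i = \<eta> i}) \<in> sets (coord_algebra V')"
    using fin meas by (intro sets.finite_UN) auto
  ultimately show ?thesis by simp
qed

lemma finite_configs: "finite V \<Longrightarrow> finite (configs V :: (int \<Rightarrow> 'a::finite) set)"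
  unfolding configs_def by (rule finite_PiE) auto

lemma restrict_in_configs [simp]: "restrict \<sigma> V \<in> configs V"
  by (auto simp: configs_def)

lemma configs_nonempty [simp]: "configs V \<noteq> {}"
  using restrict_in_configs by blast

lemma configs_eqI:
  assumes "\<eta> \<in> configs V" "\<eta>' \<in> configs V" "\<And>i. i \<in> V \<Longrightarrow> \<eta> i = \<eta>' i"
  shows "\<eta> = \<eta>'"
  using assms unfolding configs_def by (intro PiE_ext) auto

lemma restrict_configs: "\<eta> \<in> configs V \<Longrightarrow> restrict \<eta> V = \<eta>"
  by (rule configs_eqI[of _ V]) auto

lemma finite_block [simp]: "finite (block k)" by (simp add: block_def)

lemma shift_shift [simp]: "shift a (shift (- a) \<sigma>) = \<sigma>" "shift (- a) (shift a \<sigma>) = \<sigma>"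
  by (auto simp: shift_def)

section \<open>Translates and diameters of finite sets of integers\<close>

definition translate :: "int \<Rightarrow> int set \<Rightarrow> int set" where
  "translate a A = (\<lambda>j. j + a) ` A"

lemma inj_translate: "inj (translate a)"
  by (rule inj_on_inverseI[where g = "translate (- a)"]) (simp add: translate_def image_image)

lemma translate_translate [simp]: "translate a (translate b A) = translate (b + a) A"
  by (auto simp: translate_def image_image add.assoc)

lemma translate_0 [simp]: "translate 0 A = A"
  by (simp add: translate_def)

lemma translate_finite_sets [simp]: "translate a A \<in> finite_sets \<longleftrightarrow> A \<in> finite_sets"
  by (auto simp: finite_sets_def translate_def finite_image_iff inj_on_def)

lemma mem_translate: "x \<in> translate a A \<longleftrightarrow> x - a \<in> A"
proof
  assume "x - a \<in> A"
  then have "(x - a) + a \<in> translate a A" unfolding translate_def by blast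
  then show "x \<in> translate a A" by simp
qed (auto simp: translate_def)

lemma diam_translate [simp]: "diam (translate a A) = diam A"
proof -
  have "{\<bar>i - j\<bar> | i j. i \<in> translate a A \<and> j \<in> translate a A} = {\<bar>i - j\<bar> | i j. i \<in> A \<and> j \<in> A}"
  proof (intro equalityI subsetI)
    fix x assume "x \<in> {\<bar>i - j\<bar> | i j. i \<in> A \<and> j \<in> A}"
    then obtain i j where "x = \<bar>i - j\<bar>" "i \<in> A" "j \<in> A" by blast
    then have "x = \<bar>(i + a) - (j + a)\<bar>" "i + a \<in> translate a A" "j + a \<in> translate a A"
      by (auto simp: mem_translate)
    then show "x \<in> {\<bar>i - j\<bar> | i j. i \<in> translate a A \<and> j \<in> translate a A}" by blast
  next
    fix x assume "x \<in> {\<bar>i - j\<bar> | i j. i \<in> translate a A \<and> j \<in> translate a A}"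
    then obtain i j where "x = \<bar>(i - a) - (j - a)\<bar>" "i - a \<in> A" "j - a \<in> A"
      by (auto simp: mem_translate)
    then show "x \<in> {\<bar>i - j\<bar> | i j. i \<in> A \<and> j \<in> A}" by blast
  qed
  then show ?thesis by (simp add: diam_def)
qed

lemma diam_ge: "finite A \<Longrightarrow> i \<in> A \<Longrightarrow> j \<in> A \<Longrightarrow> \<bar>i - j\<bar> \<le> diam A"
  unfolding diam_def
proof (rule Max_ge)
  assume "finite A"
  have "{\<bar>i - j\<bar> | i j. i \<in> A \<and> j \<in> A} = (\<lambda>(i, j). \<bar>i - j\<bar>) ` (A \<times> A)" by auto
  with \<open>finite A\<close> show "finite {\<bar>i - j\<bar> | i j. i \<in> A \<and> j \<in> A}" by simp
qed auto

definition crosses :: "int \<Rightarrow> int set \<Rightarrow> bool" where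
  "crosses c A \<longleftrightarrow> (\<exists>x\<in>A. x < c) \<and> (\<exists>y\<in>A. c \<le> y)"

definition sup_norm :: "(int set \<Rightarrow> (int \<Rightarrow> 'a) \<Rightarrow> real) \<Rightarrow> int set \<Rightarrow> real" where
  "sup_norm U A = (SUP \<sigma>. \<bar>U A \<sigma>\<bar>)"

section \<open>Energy of the sets that cross a point\<close>

locale interaction =
  fixes U :: "int set \<Rightarrow> (int \<Rightarrow> 'a::finite) \<Rightarrow> real"
  assumes U: "U \<in> interactions"
begin

text \<open>The level set of \<open>U A\<close> through \<sigma> is a preimage of a singleton, hence
  measurable with respect to the coordinates in \<open>A\<close>, hence determined by them.\<close>

lemma U_cong:
  assumes "A \<in> finite_sets" "\<And>i. i \<in> A \<Longrightarrow> \<sigma> i = \<sigma>' i" shows "U A \<sigma> = U A \<sigma>'"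
proof -
  have "U A \<in> borel_measurable (coord_algebra A)"
    using U assms(1) by (auto simp: interactions_def)
  then have "U A -` {U A \<sigma>} \<inter> space (coord_algebra A) \<in> sets (coord_algebra A)"
    by (rule measurable_sets) auto
  then have "depends_on A (U A -` {U A \<sigma>})"
    using depends_on_coord_algebra by force
  from depends_onD[OF this, of \<sigma> \<sigma>'] assms(2) show ?thesis by auto
qed

text \<open>A real supremum is an upper bound only for a bounded range. Here the range is already
  attained on the finite set \<open>configs A\<close>.\<close>

lemma abs_U_le: assumes "A \<in> finite_sets" shows "\<bar>U A \<sigma>\<bar> \<le> sup_norm U A"
  unfolding sup_norm_def
proof (rule cSUP_upper)
  have "(\<lambda>\<sigma>. \<bar>U A \<sigma>\<bar>) ` UNIV \<subseteq> (\<lambda>\<sigma>. \<bar>U A \<sigma>\<bar>) ` configs A"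
  proof
    fix x assume "x \<in> (\<lambda>\<sigma>. \<bar>U A \<sigma>\<bar>) ` UNIV"
    then obtain \<sigma> where "x = \<bar>U A \<sigma>\<bar>" by auto
    also have "\<dots> = \<bar>U A (restrict \<sigma> A)\<bar>" using U_cong[OF assms, of \<sigma> "restrict \<sigma> A"] by simp
    finally show "x \<in> (\<lambda>\<sigma>. \<bar>U A \<sigma>\<bar>) ` configs A" by auto
  qed
  moreover have "finite (configs A :: (int \<Rightarrow> 'a) set)"
    using assms by (auto simp: finite_sets_def intro: finite_configs)
  ultimately show "bdd_above (range (\<lambda>\<sigma>. \<bar>U A \<sigma>\<bar>))"
    by (meson bdd_above_finite finite_imageI finite_subset)
qed simp

lemma sup_norm_nonneg: "A \<in> finite_sets \<Longrightarrow> 0 \<le> sup_norm U A"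
  using abs_U_le[of A undefined] by linarith

lemma U_translate: assumes "A \<in> finite_sets" shows "U (translate a A) \<sigma> = U A (shift a \<sigma>)"
proof -
  have "\<forall>A\<in>finite_sets. \<forall>i \<sigma>. U ((\<lambda>j. j + i) ` A) (shift (- i) \<sigma>) = U A \<sigma>"
    using U unfolding interactions_def by blast
  then have "U ((\<lambda>j. j + a) ` A) (shift (- a) (shift a \<sigma>)) = U A (shift a \<sigma>)"
    using assms by blast
  then show ?thesis by (simp add: translate_def)
qed

lemma sup_norm_translate: assumes "A \<in> finite_sets" shows "sup_norm U (translate a A) = sup_norm U A"
proof -
  have "range (\<lambda>\<sigma>. \<bar>U A (shift a \<sigma>)\<bar>) = range (\<lambda>\<sigma>. \<bar>U A \<sigma>\<bar>)"
  proof (intro equalityI subsetI)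
    fix x assume "x \<in> range (\<lambda>\<sigma>. \<bar>U A \<sigma>\<bar>)"
    then obtain \<sigma> where "x = \<bar>U A (shift a (shift (- a) \<sigma>))\<bar>" by auto
    then show "x \<in> range (\<lambda>\<sigma>. \<bar>U A (shift a \<sigma>)\<bar>)" by blast
  qed auto
  then show ?thesis using assms by (simp add: sup_norm_def U_translate)
qed

definition decay :: real where
  "decay = (SOME \<gamma>. \<gamma> > 0 \<and>
     (\<lambda>A. exp (\<gamma> * real_of_int (diam A)) * sup_norm U A) summable_on {A \<in> finite_sets. 0 \<in> A})"

lemma decay: "decay > 0"
  "(\<lambda>A. exp (decay * real_of_int (diam A)) * sup_norm U A) summable_on {A \<in> finite_sets. 0 \<in> A}"
proof -
  have "\<exists>\<gamma>. \<gamma> > 0 \<and>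
     (\<lambda>A. exp (\<gamma> * real_of_int (diam A)) * sup_norm U A) summable_on {A \<in> finite_sets. 0 \<in> A}"
    using U by (simp add: interactions_def sup_norm_def)
  from someI_ex[OF this] show "decay > 0"
    "(\<lambda>A. exp (decay * real_of_int (diam A)) * sup_norm U A) summable_on {A \<in> finite_sets. 0 \<in> A}"
    by (auto simp: decay_def)
qed

definition weighted_norm :: real where
  "weighted_norm = (\<Sum>\<^sub>\<infinity>A\<in>{A \<in> finite_sets. 0 \<in> A}. exp (decay * real_of_int (diam A)) * sup_norm U A)"

lemma weighted_norm_nonneg: "0 \<le> weighted_norm"
  unfolding weighted_norm_def by (intro infsum_nonneg) (auto intro!: mult_nonneg_nonneg sup_norm_nonneg)

text \<open>Translation by \<open>- x\<close> moves the common point to 0 and preserves both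
  \<open>diam\<close> and \<open>sup_norm\<close>. Bounding finite families first lets summability
  over infinite ones be deduced later.\<close>

lemma weighted_sum_le:
  assumes "finite F" "F \<subseteq> finite_sets" "\<And>A. A \<in> F \<Longrightarrow> x \<in> A"
  shows "(\<Sum>A\<in>F. exp (decay * real_of_int (diam A)) * sup_norm U A) \<le> weighted_norm"
proof -
  have "(\<Sum>A\<in>F. exp (decay * real_of_int (diam A)) * sup_norm U A) =
        (\<Sum>A\<in>translate (- x) ` F. exp (decay * real_of_int (diam A)) * sup_norm U A)"
    using assms(2) by (subst sum.reindex)
      (auto intro!: sum.cong simp: sup_norm_translate subset_iff intro: inj_on_subset[OF inj_translate])
  also have "\<dots> \<le> weighted_norm"
    unfolding weighted_norm_def using assms
    by (intro finite_sum_le_infsum decay) (auto simp: mem_translate intro!: mult_nonneg_nonneg sup_norm_nonneg)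
  finally show ?thesis .
qed

text \<open>A set \<open>A\<close> crossing \<open>c\<close> with least element \<open>x < c\<close> has diameter at least \<open>c - x\<close>, so
  grouping by \<open>x\<close> leaves a geometric series.\<close>

definition crossing_bound :: real where
  "crossing_bound = weighted_norm * (\<Sum>n. exp (- decay) ^ n)"

lemma summable_decay: "summable (\<lambda>n. exp (- decay) ^ n)"
  using decay(1) by (intro summable_geometric) simp

lemma crossing_bound_nonneg: "0 \<le> crossing_bound"
  unfolding crossing_bound_def
  by (intro mult_nonneg_nonneg weighted_norm_nonneg suminf_nonneg summable_decay) auto

lemma crossing_sum_le:
  assumes "finite F" "F \<subseteq> finite_sets" "\<And>A. A \<in> F \<Longrightarrow> crosses c A"
  shows "(\<Sum>A\<in>F. sup_norm U A) \<le> crossing_bound"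
proof -
  \<comment> \<open>Distance from the least element to the cut; it is the index of the geometric
    series.\<close>
  define g where "g A = nat (c - Min A)" for A
  have Min: "Min A \<in> A" "Min A < c" "c - Min A \<le> diam A" if "A \<in> F" for A
  proof -
    have fin: "finite A" "A \<noteq> {}" using that assms(2) by (auto simp: finite_sets_def)
    then show "Min A \<in> A" by simp
    from assms(3)[OF that] obtain x y where "x \<in> A" "x < c" "y \<in> A" "c \<le> y"
      by (auto simp: crosses_def)
    then show "Min A < c" using fin by (meson Min_le order_le_less_trans)
    have "\<bar>y - Min A\<bar> \<le> diam A" using diam_ge[OF fin(1) \<open>y \<in> A\<close> \<open>Min A \<in> A\<close>] .
    then show "c - Min A \<le> diam A" using \<open>c \<le> y\<close> by linarith
  qed
  have "(\<Sum>A\<in>F. sup_norm U A) = (\<Sum>n\<in>g ` F. \<Sum>A\<in>{A \<in> F. g A = n}. sup_norm U A)"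
    using assms(1) by (rule sum.image_gen)
  also have "\<dots> \<le> (\<Sum>n\<in>g ` F. exp (- decay) ^ n * weighted_norm)"
  proof (rule sum_mono)
    fix n assume "n \<in> g ` F"
    have "(\<Sum>A\<in>{A \<in> F. g A = n}. sup_norm U A) \<le>
      (\<Sum>A\<in>{A \<in> F. g A = n}. exp (- decay) ^ n * (exp (decay * real_of_int (diam A)) * sup_norm U A))"
    proof (rule sum_mono)
      fix A assume A: "A \<in> {A \<in> F. g A = n}"
      then have "int n = c - Min A" "c - Min A \<le> diam A" using Min[of A] by (auto simp: g_def)
      then have "real n \<le> real_of_int (diam A)" by linarith
      \<comment> \<open>The diameter is at least \<open>n\<close>, so part of the exponential weight
        can be traded for the factor \<open>exp (- decay) ^ n\<close>.\<close>
      then have "1 \<le> exp (decay * (real_of_int (diam A) - real n))" using decay(1) by simp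
      also have "\<dots> = exp (- decay) ^ n * exp (decay * real_of_int (diam A))"
        by (simp add: exp_of_nat_mult[symmetric] mult_exp_exp algebra_simps)
      finally have "1 * sup_norm U A \<le> exp (- decay) ^ n * exp (decay * real_of_int (diam A)) * sup_norm U A"
        using A assms(2) by (intro mult_right_mono sup_norm_nonneg) auto
      then show "sup_norm U A \<le> exp (- decay) ^ n * (exp (decay * real_of_int (diam A)) * sup_norm U A)"
        by (simp add: mult.assoc)
    qed
    also have "\<dots> = exp (- decay) ^ n *
        (\<Sum>A\<in>{A \<in> F. g A = n}. exp (decay * real_of_int (diam A)) * sup_norm U A)"
      by (simp add: sum_distrib_left)
    also have "\<dots> \<le> exp (- decay) ^ n * weighted_norm"
    proof (rule mult_left_mono)
      \<comment> \<open>All sets of one group share their least element, which is the common point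
        that \<open>weighted_sum_le\<close> asks for.\<close>
      have "c - int n \<in> A" if "A \<in> {A \<in> F. g A = n}" for A
      proof -
        have "c - int n = Min A" using that Min[of A] by (auto simp: g_def)
        then show ?thesis using that Min[of A] by simp
      qed
      then show "(\<Sum>A\<in>{A \<in> F. g A = n}. exp (decay * real_of_int (diam A)) * sup_norm U A) \<le> weighted_norm"
        using assms by (intro weighted_sum_le[where x = "c - int n"]) auto
    qed simp
    finally show "(\<Sum>A\<in>{A \<in> F. g A = n}. sup_norm U A) \<le> exp (- decay) ^ n * weighted_norm" .
  qed
  also have "\<dots> = weighted_norm * (\<Sum>n\<in>g ` F. exp (- decay) ^ n)"
    by (simp add: sum_distrib_left mult.commute)
  also have "\<dots> \<le> crossing_bound"
    unfolding crossing_bound_def using assms(1)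
    by (intro mult_left_mono sum_le_suminf summable_decay weighted_norm_nonneg) auto
  finally show ?thesis .
qed

end

subsection \<open>Almost additivity of the energy and the pressure\<close>

definition word :: "int \<Rightarrow> nat \<Rightarrow> (int \<Rightarrow> 'a) \<Rightarrow> int \<Rightarrow> 'a" where
  "word a k \<sigma> = restrict (shift a \<sigma>) (block k)"

lemma word_in_configs [simp]: "word a k \<sigma> \<in> configs (block k)"
  by (simp add: word_def)

lemma word_eq_iff: "word a k \<sigma> = word b k \<sigma>' \<longleftrightarrow> (\<forall>i\<in>block k. \<sigma> (a + i) = \<sigma>' (b + i))"
  (is "?l \<longleftrightarrow> ?r")
proof
  assume eq: ?l
  show ?r
  proof
    fix i assume "i \<in> block k"
    then show "\<sigma> (a + i) = \<sigma>' (b + i)" using fun_cong[OF eq, of i] by (simp add: word_def shift_def)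
  qed
qed (auto simp: word_def shift_def fun_eq_iff restrict_def)

lemma word_eq_configs_iff:
  "\<eta> \<in> configs (block k) \<Longrightarrow> word a k \<sigma> = \<eta> \<longleftrightarrow> (\<forall>i\<in>block k. \<sigma> (a + i) = \<eta> i)"
  using word_eq_iff[of a k \<sigma> 0 \<eta>] restrict_configs[of \<eta> "block k"] by (simp add: word_def shift_def)

lemma finite_subsets_block [simp]: "finite {A \<in> finite_sets. A \<subseteq> block k}"
  by (rule finite_subset[of _ "Pow (block k)"]) auto

text \<open>A two-sided form of Fekete's lemma. Its gain over plain convergence is an error bounded
  by \<open>K\<close> at every \<open>n\<close>, so that exponentials of \<open>u\<close> are
  controlled up to a constant factor.\<close>

lemma almost_additive_limit:
  fixes u :: "nat \<Rightarrow> real"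
  assumes u: "\<And>m n. \<bar>u (m + n) - u m - u n\<bar> \<le> K"
  obtains L where "(\<lambda>n. u n / real n) \<longlonglongrightarrow> L" "\<And>n. \<bar>u n - real n * L\<bar> \<le> K"
proof -
  have K: "0 \<le> K" using u[of 0 0] by linarith
  have mult: "\<bar>u (Suc m * n) - real (Suc m) * u n\<bar> \<le> real m * K" for m n
  proof (induction m)
    case (Suc m)
    have "u (Suc (Suc m) * n) = u (Suc m * n + n)" by (simp add: algebra_simps)
    with u[of "Suc m * n" n] Suc show ?case by (simp add: algebra_simps abs_le_iff)
  qed simp
  \<comment> \<open>Both \<open>m * u n\<close> and \<open>n * u m\<close> are compared with
    \<open>u (m * n)\<close>; dividing by \<open>m * n\<close> gives the bound.\<close>
  have diff: "\<bar>u m / real m - u n / real n\<bar> \<le> K / real m + K / real n" if "0 < m" "0 < n" for m n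
  proof -
    have "\<bar>u (m * n) - real m * u n\<bar> \<le> real m * K"
    proof (cases m)
      case (Suc m')
      from mult[of m' n] have "\<bar>u (m * n) - real m * u n\<bar> \<le> real m' * K" by (simp add: Suc)
      also have "\<dots> \<le> real m * K" using K by (intro mult_right_mono) (simp_all add: Suc)
      finally show ?thesis .
    qed (use that in simp)
    moreover have "\<bar>u (m * n) - real n * u m\<bar> \<le> real n * K"
    proof (cases n)
      case (Suc n')
      from mult[of n' m] have "\<bar>u (m * n) - real n * u m\<bar> \<le> real n' * K"
        by (simp add: Suc mult.commute)
      also have "\<dots> \<le> real n * K" using K by (intro mult_right_mono) (simp_all add: Suc)
      finally show ?thesis .
    qed (use that in simp)
    ultimately have "\<bar>real n * u m - real m * u n\<bar> \<le> real m * K + real n * K" by linarith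
    moreover have "u m / real m - u n / real n = (real n * u m - real m * u n) / (real m * real n)"
      using that by (simp add: field_simps)
    moreover have "K / real m + K / real n = (real m * K + real n * K) / (real m * real n)"
      using that by (simp add: field_simps)
    ultimately show ?thesis using that
      by (simp add: abs_divide abs_mult divide_right_mono)
  qed
  have "Cauchy (\<lambda>n. u n / real n)"
  proof (rule metric_CauchyI)
    fix e :: real assume "0 < e"
    obtain N where N: "real N > 2 * K / e" using reals_Archimedean2 by blast
    have "dist (u m / real m) (u n / real n) < e" if "Suc N \<le> m" "Suc N \<le> n" for m n
    proof -
      have *: "K / real k < e / 2" if "Suc N \<le> k" for k
      proof -
        have "2 * K / e < real k" using N that by linarith
        then show ?thesis using \<open>0 < e\<close> that by (simp add: field_simps)
      qed
      have "\<bar>u m / real m - u n / real n\<bar> \<le> K / real m + K / real n"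
        using that by (intro diff) auto
      with *[OF that(1)] *[OF that(2)] show ?thesis unfolding dist_real_def by linarith
    qed
    then show "\<exists>M. \<forall>m\<ge>M. \<forall>n\<ge>M. dist (u m / real m) (u n / real n) < e" by blast
  qed
  then obtain L where L: "(\<lambda>n. u n / real n) \<longlonglongrightarrow> L"
    using Cauchy_convergent convergent_def by blast
  have "\<bar>u n - real n * L\<bar> \<le> K" for n
  proof (cases "n = 0")
    case True
    then show ?thesis using u[of 0 0] by simp
  next
    case False
    \<comment> \<open>As the other index tends to infinity, only \<open>K / n\<close> remains on the
      right.\<close>
    have "(\<lambda>m. \<bar>u n / real n - u m / real m\<bar>) \<longlonglongrightarrow> \<bar>u n / real n - L\<bar>"
      by (intro tendsto_intros L)
    moreover have "(\<lambda>m. K / real n + K / real m) \<longlonglongrightarrow> K / real n + 0"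
      by (intro tendsto_intros lim_const_over_n)
    moreover have "\<forall>\<^sub>F m in sequentially. \<bar>u n / real n - u m / real m\<bar> \<le> K / real n + K / real m"
      using eventually_gt_at_top[of 0] by eventually_elim (use False in \<open>intro diff\<close>, auto)
    ultimately have "\<bar>u n / real n - L\<bar> \<le> K / real n + 0"
      by (intro tendsto_le[of sequentially]) auto
    then have "real n * \<bar>u n / real n - L\<bar> \<le> real n * (K / real n)" by (intro mult_left_mono) auto
    moreover have "real n * \<bar>u n / real n - L\<bar> = \<bar>real n * (u n / real n - L)\<bar>" by (simp add: abs_mult)
    ultimately show ?thesis using False by (simp add: algebra_simps)
  qed
  with L show ?thesis using that by blast
qed

context interaction
begin

definition energy :: "nat \<Rightarrow> (int \<Rightarrow> 'a) \<Rightarrow> real" where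
  "energy k \<sigma> = (\<Sum>A | A \<in> finite_sets \<and> A \<subseteq> block k. U A \<sigma>)"

text \<open>The partition function of \<open>scale_interaction q U\<close> with free boundary. Only
  q = 1 and q = 2 matter in the end: the first normalises the weights, the second sums their
  squares.\<close>

definition partition :: "real \<Rightarrow> nat \<Rightarrow> real" where
  "partition q k = (\<Sum>\<eta>\<in>configs (block k). exp (- (q * energy k \<eta>)))"

lemma energy_cong: "(\<And>i. i \<in> block k \<Longrightarrow> \<sigma> i = \<sigma>' i) \<Longrightarrow> energy k \<sigma> = energy k \<sigma>'"
  unfolding energy_def by (intro sum.cong refl U_cong) auto

lemma energy_restrict [simp]: "energy k (restrict \<sigma> (block k)) = energy k \<sigma>"
  by (rule energy_cong) simp

lemma energy_word [simp]: "energy k (word a k \<sigma>) = energy k (shift a \<sigma>)"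
  by (simp add: word_def)

lemma subsets_translate_block:
  "{A \<in> finite_sets. A \<subseteq> translate a (block k)} = translate a ` {A \<in> finite_sets. A \<subseteq> block k}"
proof (intro equalityI subsetI)
  fix A assume A: "A \<in> {A \<in> finite_sets. A \<subseteq> translate a (block k)}"
  then have "translate (- a) A \<in> {A \<in> finite_sets. A \<subseteq> block k}"
    by (auto simp: mem_translate subset_iff)
  then have "translate a (translate (- a) A) \<in> translate a ` {A \<in> finite_sets. A \<subseteq> block k}" by blast
  then show "A \<in> translate a ` {A \<in> finite_sets. A \<subseteq> block k}" by simp
qed (auto simp: mem_translate)

lemma sum_translate_block:
  "(\<Sum>A | A \<in> finite_sets \<and> A \<subseteq> translate a (block k). U A \<sigma>) = energy k (shift a \<sigma>)"
  unfolding subsets_translate_block energy_def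
  by (subst sum.reindex) (auto intro: inj_on_subset[OF inj_translate] simp: U_translate)

lemma partition_pos: "0 < partition q k"
  unfolding partition_def by (intro sum_pos finite_configs) auto

text \<open>A set inside the long block lies in the left part, lies in the right part, or crosses
  \<open>int m + 1\<close>, the first site of the right part. The last kind costs at most
  \<open>crossing_bound\<close>, whatever the lengths.\<close>

lemma energy_add: "\<bar>energy (m + n) \<sigma> - energy m \<sigma> - energy n (shift (int m) \<sigma>)\<bar> \<le> crossing_bound"
proof -
  define S where "S k = {A \<in> finite_sets. A \<subseteq> block k}" for k
  define S' where "S' = {A \<in> finite_sets. A \<subseteq> translate (int m) (block n)}"
  define C where "C = {A \<in> finite_sets. A \<subseteq> block (m + n) \<and> crosses (int m + 1) A}"
  have S: "S (m + n) = S m \<union> S' \<union> C"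
  proof (intro equalityI subsetI)
    fix A assume "A \<in> S (m + n)"
    then have A: "A \<in> finite_sets" "A \<subseteq> block (m + n)" by (auto simp: S_def)
    consider "crosses (int m + 1) A" | "\<forall>x\<in>A. int m + 1 \<le> x" | "\<forall>x\<in>A. x < int m + 1"
      unfolding crosses_def by (meson not_le)
    then show "A \<in> S m \<union> S' \<union> C"
    proof cases
      case 1
      with A show ?thesis by (auto simp: C_def)
    next
      case 2
      have "x \<in> translate (int m) (block n)" if "x \<in> A" for x
        using 2 A(2) that by (force simp: mem_translate block_def)
      with A have "A \<in> S'" by (auto simp: S'_def)
      then show ?thesis by blast
    next
      case 3
      have "x \<in> block m" if "x \<in> A" for x
        using 3 A(2) that by (force simp: block_def)
      with A have "A \<in> S m" by (auto simp: S_def)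
      then show ?thesis by blast
    qed
  qed (auto simp: S_def S'_def C_def block_def mem_translate subset_iff)
  have fin: "finite (S m)" "finite S'" "finite C"
    unfolding S_def S'_def C_def subsets_translate_block
    by (auto intro: finite_subset[OF _ finite_subsets_block[of "m + n"]])
  have "(S m \<union> S') \<inter> C = {}"
    unfolding S_def S'_def C_def by (fastforce simp: block_def mem_translate subset_iff crosses_def)
  have "S m \<inter> S' = {}"
    unfolding S_def S'_def finite_sets_def
    by (fastforce simp: block_def mem_translate subset_iff)
  have "energy (m + n) \<sigma> = energy m \<sigma> + energy n (shift (int m) \<sigma>) + (\<Sum>A\<in>C. U A \<sigma>)"
  proof -
    have "energy (m + n) \<sigma> = (\<Sum>A\<in>S m \<union> S' \<union> C. U A \<sigma>)"
      unfolding S[symmetric] by (simp add: energy_def S_def)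
    also have "\<dots> = (\<Sum>A\<in>S m. U A \<sigma>) + (\<Sum>A\<in>S'. U A \<sigma>) + (\<Sum>A\<in>C. U A \<sigma>)"
      using fin \<open>(S m \<union> S') \<inter> C = {}\<close> \<open>S m \<inter> S' = {}\<close> by (simp add: sum.union_disjoint)
    finally show ?thesis
      unfolding sum_translate_block[symmetric] by (simp add: energy_def S_def S'_def)
  qed
  moreover have "\<bar>\<Sum>A\<in>C. U A \<sigma>\<bar> \<le> (\<Sum>A\<in>C. sup_norm U A)"
    by (rule order_trans[OF sum_abs], rule sum_mono) (auto simp: C_def intro: abs_U_le)
  moreover have "(\<Sum>A\<in>C. sup_norm U A) \<le> crossing_bound"
    using fin by (intro crossing_sum_le) (auto simp: C_def)
  ultimately show ?thesis by linarith
qed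

lemma bij_betw_split_configs:
  "bij_betw (\<lambda>\<eta>. (word 0 m \<eta>, word (int m) n \<eta>)) (configs (block (m + n)))
     (configs (block m) \<times> (configs (block n) :: (int \<Rightarrow> 'a) set))"
proof (rule bij_betw_imageI)
  show "inj_on (\<lambda>\<eta>::int \<Rightarrow> 'a. (word 0 m \<eta>, word (int m) n \<eta>)) (configs (block (m + n)))"
  proof (rule inj_onI)
    fix \<eta> \<eta>' :: "int \<Rightarrow> 'a"
    assume *: "\<eta> \<in> configs (block (m + n))" "\<eta>' \<in> configs (block (m + n))"
      "(word 0 m \<eta>, word (int m) n \<eta>) = (word 0 m \<eta>', word (int m) n \<eta>')"
    show "\<eta> = \<eta>'"
    proof (rule configs_eqI[OF *(1,2)])
      fix i assume i: "i \<in> block (m + n)"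
      show "\<eta> i = \<eta>' i"
      proof (cases "i \<le> int m")
        case True
        with i *(3) show ?thesis by (auto simp: word_eq_iff block_def)
      next
        case False
        then have "i - int m \<in> block n" using i by (auto simp: block_def)
        with *(3) have "\<eta> (int m + (i - int m)) = \<eta>' (int m + (i - int m))"
          by (auto simp: word_eq_iff)
        then show ?thesis by simp
      qed
    qed
  qed
  show "(\<lambda>\<eta>. (word 0 m \<eta>, word (int m) n \<eta>)) ` configs (block (m + n)) =
      configs (block m) \<times> (configs (block n) :: (int \<Rightarrow> 'a) set)"
  proof (intro equalityI subsetI)
    fix p :: "(int \<Rightarrow> 'a) \<times> (int \<Rightarrow> 'a)" assume "p \<in> configs (block m) \<times> configs (block n)"
    then obtain \<eta> \<xi> where p: "p = (\<eta>, \<xi>)" "\<eta> \<in> configs (block m)" "\<xi> \<in> configs (block n)" by auto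
    define \<rho> where "\<rho> = restrict (\<lambda>i. if i \<le> int m then \<eta> i else \<xi> (i - int m)) (block (m + n))"
    have "word 0 m \<rho> = \<eta>" "word (int m) n \<rho> = \<xi>"
      using p by (auto simp: word_eq_configs_iff \<rho>_def block_def)
    moreover have "\<rho> \<in> configs (block (m + n))" by (simp add: \<rho>_def)
    ultimately show "p \<in> (\<lambda>\<eta>. (word 0 m \<eta>, word (int m) n \<eta>)) ` configs (block (m + n))"
      unfolding p(1) by (intro image_eqI[of _ _ \<rho>]) auto
  qed auto
qed

text \<open>Without the crossing terms the sum over configurations factorises. Restoring them
  changes each exponent by at most |q| times \<open>crossing_bound\<close>.\<close>

lemma ln_partition_add:
  "\<bar>ln (partition q (m + n)) - ln (partition q m) - ln (partition q n)\<bar> \<le> \<bar>q\<bar> * crossing_bound"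
proof -
  define K where "K = \<bar>q\<bar> * crossing_bound"
  \<comment> \<open>The weight of a configuration whose two parts do not interact.\<close>
  define e where "e \<eta> = exp (- (q * energy m \<eta>)) * exp (- (q * energy n (shift (int m) \<eta>)))"
    for \<eta> :: "int \<Rightarrow> 'a"
  have shift0: "shift 0 \<sigma> = \<sigma>" for \<sigma> :: "int \<Rightarrow> 'a" by (simp add: shift_def)
  have "(\<Sum>\<eta>\<in>configs (block (m + n)). e \<eta>) =
        (\<Sum>(\<eta>, \<xi>)\<in>configs (block m) \<times> configs (block n).
          exp (- (q * energy m \<eta>)) * exp (- (q * energy n \<xi>)))"
    using bij_betw_split_configs[of m n]
    by (subst sum.reindex_bij_betw[OF bij_betw_split_configs[of m n], symmetric])
      (simp add: e_def shift0)
  also have "\<dots> = partition q m * partition q n"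
    unfolding partition_def by (simp add: sum_product sum.cartesian_product)
  finally have e_sum: "(\<Sum>\<eta>\<in>configs (block (m + n)). e \<eta>) = partition q m * partition q n" .
  have bound: "\<bar>q * energy (m + n) \<eta> - q * energy m \<eta> - q * energy n (shift (int m) \<eta>)\<bar> \<le> K" for \<eta>
  proof -
    have "\<bar>q * energy (m + n) \<eta> - q * energy m \<eta> - q * energy n (shift (int m) \<eta>)\<bar> =
      \<bar>q\<bar> * \<bar>energy (m + n) \<eta> - energy m \<eta> - energy n (shift (int m) \<eta>)\<bar>"
      by (simp add: abs_mult[symmetric] algebra_simps)
    also have "\<dots> \<le> K" unfolding K_def by (intro mult_left_mono energy_add) simp
    finally show ?thesis .
  qed
  have "partition q (m + n) \<le> (\<Sum>\<eta>\<in>configs (block (m + n)). exp K * e \<eta>)"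
    unfolding partition_def e_def mult_exp_exp
    by (intro sum_mono) (use bound in \<open>auto simp: abs_le_iff algebra_simps\<close>)
  then have "partition q (m + n) \<le> exp K * (partition q m * partition q n)"
    by (simp add: sum_distrib_left[symmetric] e_sum)
  then have "ln (partition q (m + n)) \<le> ln (exp K * (partition q m * partition q n))"
    using partition_pos by (subst ln_le_cancel_iff) auto
  moreover have "(\<Sum>\<eta>\<in>configs (block (m + n)). exp (- K) * e \<eta>) \<le> partition q (m + n)"
    unfolding partition_def e_def mult_exp_exp
    by (intro sum_mono) (use bound in \<open>auto simp: abs_le_iff algebra_simps\<close>)
  then have "exp (- K) * (partition q m * partition q n) \<le> partition q (m + n)"
    by (simp add: sum_distrib_left[symmetric] e_sum)
  then have "ln (exp (- K) * (partition q m * partition q n)) \<le> ln (partition q (m + n))"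
    using partition_pos by (subst ln_le_cancel_iff) auto
  moreover have "ln (exp c * (partition q m * partition q n)) = c + ln (partition q m) + ln (partition q n)" for c
    using partition_pos[of q m] partition_pos[of q n] by (simp add: ln_mult)
  ultimately show ?thesis unfolding K_def[symmetric] by simp
qed

text \<open>This also settles that the limit defining the pressure exists. The error is independent
  of \<open>n\<close>, so the partition function is known up to a constant factor and not merely on
  the exponential scale.\<close>

lemma ln_partition_bound:
  "\<bar>ln (partition q n) - real n * pressure (scale_interaction q U)\<bar> \<le> \<bar>q\<bar> * crossing_bound"
proof -
  obtain L where L: "(\<lambda>n. ln (partition q n) / real n) \<longlonglongrightarrow> L"
    "\<And>n. \<bar>ln (partition q n) - real n * L\<bar> \<le> \<bar>q\<bar> * crossing_bound"
    using almost_additive_limit[OF ln_partition_add[of q]] by blast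
  have "pressure (scale_interaction q U) = lim (\<lambda>n. ln (partition q n) / real n)"
    unfolding pressure_def scale_interaction_def partition_def energy_def
    by (simp add: sum_distrib_left)
  also have "\<dots> = L" using L(1) by (rule limI)
  finally show ?thesis using L(2) by simp
qed

text \<open>Sets inside the window give the energy of the word. Every other set meeting the window
  crosses its left end \<open>a + 1\<close> or its right end \<open>a + int k + 1\<close>, and each
  end costs one \<open>crossing_bound\<close>, uniformly in the boundary condition.\<close>

lemma Hamiltonian_bound:
  assumes "\<eta> \<in> configs (block k)"
  shows "\<bar>Hamiltonian U (translate a (block k)) \<zeta> (restrict (shift (- a) \<eta>) (translate a (block k)))
          - energy k \<eta>\<bar> \<le> 2 * crossing_bound"
proof -
  define \<Lambda> where "\<Lambda> = translate a (block k)"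
  define \<tau> where "\<tau> = override_on \<zeta> (restrict (shift (- a) \<eta>) \<Lambda>) \<Lambda>"
  define I where "I = {A \<in> finite_sets. A \<subseteq> \<Lambda>}"
  define R where "R = {A \<in> finite_sets. A \<inter> \<Lambda> \<noteq> {} \<and> \<not> A \<subseteq> \<Lambda>}"
  have I_R: "{A \<in> finite_sets. A \<inter> \<Lambda> \<noteq> {}} = I \<union> R" "I \<inter> R = {}"
    by (auto simp: I_def R_def finite_sets_def)
  have fin: "finite I" by (simp add: I_def \<Lambda>_def subsets_translate_block)
  have cross: "crosses (a + 1) A \<or> crosses (a + int k + 1) A" if "A \<in> R" for A
  proof -
    from that obtain x y where "x \<in> A" "x \<in> \<Lambda>" "y \<in> A" "y \<notin> \<Lambda>" by (auto simp: R_def)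
    moreover from this have "a + 1 \<le> x" "x \<le> a + int k" "y < a + 1 \<or> a + int k + 1 \<le> y"
      by (auto simp: \<Lambda>_def mem_translate block_def)
    ultimately show ?thesis unfolding crosses_def by force
  qed
  \<comment> \<open>This bound on finite families yields the absolute convergence of the boundary
    part as well as its size. A set crossing both ends is counted twice, which is harmless for
    nonnegative terms.\<close>
  have sums: "(\<Sum>A\<in>F. \<bar>U A \<tau>\<bar>) \<le> 2 * crossing_bound" if F: "finite F" "F \<subseteq> R" for F
  proof -
    have "(\<Sum>A\<in>F. \<bar>U A \<tau>\<bar>) \<le> (\<Sum>A\<in>F. sup_norm U A)"
      using F by (intro sum_mono abs_U_le) (auto simp: R_def)
    also have "\<dots> \<le> (\<Sum>A\<in>{A \<in> F. crosses (a + 1) A} \<union> {A \<in> F. crosses (a + int k + 1) A}. sup_norm U A)"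
      using F cross by (intro sum_mono2) (auto simp: R_def intro: sup_norm_nonneg)
    also have "\<dots> \<le> (\<Sum>A | A \<in> F \<and> crosses (a + 1) A. sup_norm U A) +
        (\<Sum>A | A \<in> F \<and> crosses (a + int k + 1) A. sup_norm U A)"
      using F by (subst sum.union_inter[symmetric])
        (auto intro!: sum_nonneg sup_norm_nonneg simp: R_def)
    also have "\<dots> \<le> crossing_bound + crossing_bound"
      using F by (intro add_mono crossing_sum_le) (auto simp: R_def)
    finally show ?thesis by simp
  qed
  have summable: "(\<lambda>A. \<bar>U A \<tau>\<bar>) summable_on R"
    by (rule nonneg_bdd_above_summable_on) (auto intro!: bdd_aboveI2 sums)
  then have abs_summable: "(\<lambda>A. norm (U A \<tau>)) summable_on R" by simp
  then have "(\<lambda>A. U A \<tau>) summable_on R" by (rule abs_summable_summable)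
  then have "Hamiltonian U \<Lambda> \<zeta> (restrict (shift (- a) \<eta>) \<Lambda>) =
      (\<Sum>\<^sub>\<infinity>A\<in>I. U A \<tau>) + (\<Sum>\<^sub>\<infinity>A\<in>R. U A \<tau>)"
    unfolding Hamiltonian_def I_R(1) \<tau>_def[symmetric]
    using fin I_R(2) by (intro infsum_Un_disjoint) (auto intro: summable_on_finite)
  moreover have "(\<Sum>\<^sub>\<infinity>A\<in>I. U A \<tau>) = energy k (shift a \<tau>)"
    using fin by (simp add: I_def \<Lambda>_def sum_translate_block[symmetric])
  moreover have "energy k (shift a \<tau>) = energy k \<eta>"
    by (rule energy_cong) (simp add: shift_def \<tau>_def \<Lambda>_def mem_translate)
  moreover have "\<bar>\<Sum>\<^sub>\<infinity>A\<in>R. U A \<tau>\<bar> \<le> (\<Sum>\<^sub>\<infinity>A\<in>R. \<bar>U A \<tau>\<bar>)"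
    using norm_infsum_bound[OF abs_summable] by simp
  moreover have "(\<Sum>\<^sub>\<infinity>A\<in>R. \<bar>U A \<tau>\<bar>) \<le> 2 * crossing_bound"
    by (rule infsum_le_finite_sums[OF summable]) (use sums in auto)
  ultimately show ?thesis unfolding \<Lambda>_def[symmetric] by simp
qed

end

subsection \<open>Conditional probabilities of words\<close>

locale gibbs = interaction U for U :: "int set \<Rightarrow> (int \<Rightarrow> 'a::finite) \<Rightarrow> real" +
  fixes P :: "(int \<Rightarrow> 'a) measure"
  assumes gibbs: "gibbs_measure U P"
begin

sublocale prob_space P
  using gibbs by (simp add: gibbs_measure_def)

lemma sets_P: "sets P = sets Omega"
  using gibbs by (simp add: gibbs_measure_def)

lemma space_P [simp]: "space P = UNIV"
  using sets_eq_imp_space_eq[OF sets_P] by simp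

text \<open>The finite-volume Gibbs distribution with free boundary. It depends neither on the
  position of the window nor on its surroundings.\<close>

definition weight :: "nat \<Rightarrow> (int \<Rightarrow> 'a) \<Rightarrow> real" where
  "weight k \<eta> = exp (- energy k \<eta>) / partition 1 k"

lemma weight_pos: "0 < weight k \<eta>"
  using partition_pos[of 1 k] by (simp add: weight_def)

lemma sum_weight: "(\<Sum>\<eta>\<in>configs (block k). weight k \<eta>) = 1"
  using partition_pos[of 1 k]
  by (simp add: weight_def sum_divide_distrib[symmetric]) (simp add: partition_def)

lemma bij_betw_translate_configs:
  "bij_betw (\<lambda>\<eta>. restrict (shift (- a) \<eta>) (translate a (block k)))
     (configs (block k)) (configs (translate a (block k)) :: (int \<Rightarrow> 'a) set)"
proof (rule bij_betw_byWitness[where f' = "word a k"])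
  show "\<forall>\<eta>\<in>configs (block k). word a k (restrict (shift (- a) \<eta>) (translate a (block k))) = \<eta>"
    by (auto simp: word_eq_configs_iff mem_translate shift_def)
  show "\<forall>\<xi>\<in>configs (translate a (block k)).
      restrict (shift (- a) (word a k \<xi>)) (translate a (block k)) = \<xi>"
    by (auto intro!: configs_eqI[of _ "translate a (block k)"] simp: word_def shift_def mem_translate)
qed auto

text \<open>The numerator and the normalising sum are each off by at most a factor exp(2
  \<open>crossing_bound\<close>), which together give \<open>D\<close>.\<close>

lemma specification_bounds:
  fixes a :: int
  assumes "\<eta> \<in> configs (block k)"
  defines "\<Lambda> \<equiv> translate a (block k)" and "D \<equiv> exp (4 * crossing_bound)"
  defines "g \<equiv> \<lambda>\<zeta>. exp (- Hamiltonian U \<Lambda> \<zeta> (restrict (shift (- a) \<eta>) \<Lambda>)) /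
      (\<Sum>\<xi>\<in>configs \<Lambda>. exp (- Hamiltonian U \<Lambda> \<zeta> \<xi>))"
  shows "weight k \<eta> / D \<le> g \<zeta>" "g \<zeta> \<le> D * weight k \<eta>"
proof -
  define K where "K = 2 * crossing_bound"
  define h where "h \<eta> = exp (- Hamiltonian U \<Lambda> \<zeta> (restrict (shift (- a) \<eta>) \<Lambda>))" for \<eta>
  have h: "exp (- K) * exp (- energy k \<eta>) \<le> h \<eta>" "h \<eta> \<le> exp K * exp (- energy k \<eta>)"
    if "\<eta> \<in> configs (block k)" for \<eta>
    using Hamiltonian_bound[OF that, of a \<zeta>]
    by (auto simp: h_def K_def \<Lambda>_def mult_exp_exp abs_le_iff)
  have sum_h: "(\<Sum>\<xi>\<in>configs \<Lambda>. exp (- Hamiltonian U \<Lambda> \<zeta> \<xi>)) = (\<Sum>\<eta>\<in>configs (block k). h \<eta>)"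
    unfolding h_def \<Lambda>_def by (rule sum.reindex_bij_betw[OF bij_betw_translate_configs, symmetric])
  have Z: "partition 1 k = (\<Sum>\<eta>\<in>configs (block k). exp (- energy k \<eta>))"
    by (simp add: partition_def)
  have lo: "exp (- K) * partition 1 k \<le> (\<Sum>\<eta>\<in>configs (block k). h \<eta>)"
    unfolding Z sum_distrib_left by (intro sum_mono h)
  have hi: "(\<Sum>\<eta>\<in>configs (block k). h \<eta>) \<le> exp K * partition 1 k"
    unfolding Z sum_distrib_left by (intro sum_mono h)
  have D: "D = exp K * exp K" by (simp add: D_def K_def mult_exp_exp)
  have pos: "0 < partition 1 k" by (rule partition_pos)
  have "g \<zeta> \<le> (exp K * exp (- energy k \<eta>)) / (exp (- K) * partition 1 k)"
    unfolding g_def sum_h h_def[symmetric] using lo h[OF assms(1)] pos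
    by (intro frac_le) auto
  also have "\<dots> = D * weight k \<eta>" using pos by (simp add: D weight_def exp_minus field_simps)
  finally show "g \<zeta> \<le> D * weight k \<eta>" .
  have "weight k \<eta> / D = (exp (- K) * exp (- energy k \<eta>)) / (exp K * partition 1 k)"
    using pos by (simp add: D weight_def exp_minus field_simps)
  also have "\<dots> \<le> g \<zeta>"
  proof -
    have "0 < (\<Sum>\<eta>\<in>configs (block k). h \<eta>)"
      using lo pos by (smt (verit) exp_gt_zero mult_pos_pos)
    then show ?thesis
      unfolding g_def sum_h h_def[symmetric] using hi h[OF assms(1)]
      by (intro frac_le) (auto simp: h_def)
  qed
  finally show "weight k \<eta> / D \<le> g \<zeta>" .
qed

text \<open>An event determined off the window belongs to the conditioning sigma-field, so the
  probability of the intersection is the integral over \<open>E\<close> of the conditional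
  probability, and the pointwise bounds on the latter integrate.\<close>

lemma cylinder_bounds:
  assumes \<eta>: "\<eta> \<in> configs (block k)" and "0 < k"
    and "finite V" "V \<inter> translate a (block k) = {}" "depends_on V E"
  defines "D \<equiv> exp (4 * crossing_bound)"
  shows "prob ({\<sigma>. word a k \<sigma> = \<eta>} \<inter> E) \<le> D * weight k \<eta> * prob E"
    and "weight k \<eta> * prob E \<le> D * prob ({\<sigma>. word a k \<sigma> = \<eta>} \<inter> E)"
proof -
  define \<Lambda> where "\<Lambda> = translate a (block k)"
  define \<xi> where "\<xi> = restrict (shift (- a) \<eta>) \<Lambda>"
  define F where "F = (coord_algebra (- \<Lambda>) :: (int \<Rightarrow> 'a) measure)"
  define g where "g \<zeta> = exp (- Hamiltonian U \<Lambda> \<zeta> \<xi>) /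
      (\<Sum>\<xi>\<in>configs \<Lambda>. exp (- Hamiltonian U \<Lambda> \<zeta> \<xi>))" for \<zeta>
  define C where "C = {\<sigma>. restrict \<sigma> \<Lambda> = \<xi>}"
  define f where "f = real_cond_exp P F (indicator C)"
  \<comment> \<open>The Gibbs condition speaks of nonempty windows, hence
    \<open>0 < k\<close>.\<close>
  have \<Lambda>: "finite \<Lambda>" "\<Lambda> \<in> finite_sets"
    using \<open>0 < k\<close> by (auto simp: \<Lambda>_def finite_sets_def translate_def block_def)
  have C_eq: "C = {\<sigma>. word a k \<sigma> = \<eta>}"
  proof (intro set_eqI)
    fix \<sigma>
    have "\<sigma> \<in> C \<longleftrightarrow> (\<forall>i\<in>\<Lambda>. \<sigma> i = \<eta> (i - a))"
      by (auto simp: C_def \<xi>_def fun_eq_iff restrict_def shift_def)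
    also have "\<dots> \<longleftrightarrow> (\<forall>i\<in>block k. \<sigma> (a + i) = \<eta> i)"
      unfolding \<Lambda>_def translate_def by (auto simp: add.commute)
    finally show "\<sigma> \<in> C \<longleftrightarrow> \<sigma> \<in> {\<sigma>. word a k \<sigma> = \<eta>}" by (simp add: word_eq_configs_iff[OF \<eta>])
  qed
  have "depends_on \<Lambda> C"
  proof (rule depends_onI)
    fix \<sigma> \<sigma>' :: "int \<Rightarrow> 'a" assume "\<And>i. i \<in> \<Lambda> \<Longrightarrow> \<sigma> i = \<sigma>' i" "\<sigma> \<in> C"
    moreover from this have "restrict \<sigma> \<Lambda> = restrict \<sigma>' \<Lambda>" by (auto simp: restrict_def)
    ultimately show "\<sigma>' \<in> C" by (simp add: C_def)
  qed
  then have C: "C \<in> sets P"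
    using coord_algebra_if_depends_on[OF \<Lambda>(1) _ order_refl] sets_coord_algebra_subset sets_P by blast
  have E: "E \<in> sets F"
    unfolding F_def using assms(3-5) by (intro coord_algebra_if_depends_on[of V]) (auto simp: \<Lambda>_def)
  have "subalgebra P F"
    unfolding subalgebra_def F_def using sets_coord_algebra_subset sets_P by auto
  then interpret sub: finite_measure_subalgebra P F
    by unfold_locales
  have E_P: "E \<in> sets P"
    using E sets_coord_algebra_subset sets_P unfolding F_def by blast
  have int: "integrable P (indicator C :: _ \<Rightarrow> real)"
    using C by (simp add: integrable_indicator_iff less_top[symmetric])
  have "AE \<zeta> in P. \<forall>\<xi>\<in>configs \<Lambda>.
        real_cond_exp P F (indicator {\<sigma>. restrict \<sigma> \<Lambda> = \<xi>}) \<zeta> =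
        exp (- Hamiltonian U \<Lambda> \<zeta> \<xi>) / (\<Sum>\<xi>'\<in>configs \<Lambda>. exp (- Hamiltonian U \<Lambda> \<zeta> \<xi>'))"
    using gibbs \<Lambda>(2) unfolding gibbs_measure_def F_def by blast
  moreover have "\<xi> \<in> configs \<Lambda>" by (simp add: \<xi>_def)
  ultimately have f_g: "AE \<zeta> in P. f \<zeta> = g \<zeta>"
    unfolding f_def g_def C_def by (auto elim!: eventually_mono)
  have g: "weight k \<eta> / D \<le> g \<zeta>" "g \<zeta> \<le> D * weight k \<eta>" for \<zeta>
    unfolding g_def \<xi>_def \<Lambda>_def D_def by (rule specification_bounds[OF \<eta>])+
  have int_f: "integrable P (\<lambda>\<zeta>. indicator E \<zeta> *\<^sub>R f \<zeta>)"
    unfolding f_def by (intro integrable_mult_indicator E_P sub.real_cond_exp_int(1) int)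
  have int_E: "integrable P (\<lambda>\<zeta>. indicator E \<zeta> *\<^sub>R c)" for c :: real
    by (intro integrable_mult_indicator E_P) auto
  have val: "(\<integral>\<zeta>. indicator E \<zeta> *\<^sub>R c \<partial>P) = c * prob E" for c :: real
    using E_P by simp
  have "prob (C \<inter> E) = (\<integral>\<zeta>\<in>E. indicator C \<zeta> \<partial>P)"
    using C E_P by (simp add: set_lebesgue_integral_def indicator_inter_arith[symmetric] Int_commute)
  also have "\<dots> = (\<integral>\<zeta>\<in>E. f \<zeta> \<partial>P)"
    unfolding f_def by (rule sub.real_cond_exp_intA[OF int E])
  finally have eq: "prob (C \<inter> E) = (\<integral>\<zeta>. indicator E \<zeta> *\<^sub>R f \<zeta> \<partial>P)"
    by (simp add: set_lebesgue_integral_def)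
  have "(\<integral>\<zeta>. indicator E \<zeta> *\<^sub>R f \<zeta> \<partial>P) \<le> (\<integral>\<zeta>. indicator E \<zeta> *\<^sub>R (D * weight k \<eta>) \<partial>P)"
  proof (intro integral_mono_AE int_f int_E eventually_mono[OF f_g])
    fix \<zeta> assume "f \<zeta> = g \<zeta>"
    then show "indicator E \<zeta> *\<^sub>R f \<zeta> \<le> indicator E \<zeta> *\<^sub>R (D * weight k \<eta>)"
      using g(2)[of \<zeta>] by (intro scaleR_left_mono) auto
  qed
  then show "prob ({\<sigma>. word a k \<sigma> = \<eta>} \<inter> E) \<le> D * weight k \<eta> * prob E"
    unfolding val eq[symmetric] C_eq .
  have "(\<integral>\<zeta>. indicator E \<zeta> *\<^sub>R (weight k \<eta> / D) \<partial>P) \<le> (\<integral>\<zeta>. indicator E \<zeta> *\<^sub>R f \<zeta> \<partial>P)"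
  proof (intro integral_mono_AE int_f int_E eventually_mono[OF f_g])
    fix \<zeta> assume "f \<zeta> = g \<zeta>"
    then show "indicator E \<zeta> *\<^sub>R (weight k \<eta> / D) \<le> indicator E \<zeta> *\<^sub>R f \<zeta>"
      using g(1)[of \<zeta>] by (intro scaleR_left_mono) auto
  qed
  then show "weight k \<eta> * prob E \<le> D * prob ({\<sigma>. word a k \<sigma> = \<eta>} \<inter> E)"
    unfolding val eq[symmetric] C_eq by (simp add: D_def field_simps)
qed

end

subsection \<open>Quasi-product measures\<close>

lemma finite_translate_block [simp]: "finite (translate a (block k))"
  by (simp add: translate_def)

lemma depends_on_word: "depends_on (translate a (block k)) {\<sigma>. Q (word a k \<sigma>)}"
proof (rule depends_onI)
  fix \<sigma> \<sigma>' :: "int \<Rightarrow> 'a"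
  assume eq: "\<And>i. i \<in> translate a (block k) \<Longrightarrow> \<sigma> i = \<sigma>' i" and "\<sigma> \<in> {\<sigma>. Q (word a k \<sigma>)}"
  have "word a k \<sigma> = word a k \<sigma>'"
    unfolding word_eq_iff by (auto intro!: eq simp: mem_translate)
  then show "\<sigma>' \<in> {\<sigma>. Q (word a k \<sigma>)}" using \<open>\<sigma> \<in> _\<close> by simp
qed

definition matches :: "int \<Rightarrow> int \<Rightarrow> nat \<Rightarrow> (int \<Rightarrow> 'a) set" where
  "matches a b k = {\<sigma>. word a k \<sigma> = word b k \<sigma>}"

lemma matches_commute: "matches a b k = matches b a k"
  by (auto simp: matches_def)

lemma depends_on_matches: "depends_on (translate a (block k) \<union> translate b (block k)) (matches a b k)"
proof (rule depends_onI)
  fix \<sigma> \<sigma>' :: "int \<Rightarrow> 'a"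
  assume eq: "\<And>i. i \<in> translate a (block k) \<union> translate b (block k) \<Longrightarrow> \<sigma> i = \<sigma>' i"
    and "\<sigma> \<in> matches a b k"
  have "word a k \<sigma> = word a k \<sigma>'" "word b k \<sigma> = word b k \<sigma>'"
    unfolding word_eq_iff by (auto intro!: eq simp: mem_translate)
  then show "\<sigma>' \<in> matches a b k" using \<open>\<sigma> \<in> _\<close> by (simp add: matches_def)
qed

lemma depends_on_UN:
  fixes S :: "'b \<Rightarrow> (int \<Rightarrow> 'a) set"
  assumes "\<And>i. i \<in> I \<Longrightarrow> depends_on V (S i)"
  shows "depends_on V (\<Union>i\<in>I. S i)"
proof (rule depends_onI)
  fix \<sigma> \<sigma>' :: "int \<Rightarrow> 'a"
  assume "\<And>i. i \<in> V \<Longrightarrow> \<sigma> i = \<sigma>' i" "\<sigma> \<in> (\<Union>i\<in>I. S i)"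
  then show "\<sigma>' \<in> (\<Union>i\<in>I. S i)" using depends_onD[OF assms, of _ \<sigma> \<sigma>'] by blast
qed

text \<open>Blocks start at 1, so \<open>translate a (block k)\<close> consists of the sites from a
  + 1 to a + k, and equality in the hypothesis means adjacent windows.\<close>

lemma translate_block_disjoint:
  "a + int k \<le> b \<Longrightarrow> translate a (block k) \<inter> translate b (block m) = {}"
  by (auto simp: mem_translate block_def)

context prob_space
begin

text \<open>The second moment method, from the inequality \<open>1 \<ge> 2 t X - t\<^sup>2 X\<^sup>2\<close>, applied where the
  number \<open>X\<close> of occurring events is positive.\<close>

lemma prob_Union_ge_second_moment:
  assumes "finite I" "\<And>i. i \<in> I \<Longrightarrow> A i \<in> events"
  shows "2 * t * (\<Sum>i\<in>I. prob (A i)) - t\<^sup>2 * (\<Sum>i\<in>I. \<Sum>j\<in>I. prob (A i \<inter> A j)) \<le> prob (\<Union>i\<in>I. A i)"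
proof -
  define X where "X \<omega> = (\<Sum>i\<in>I. indicator (A i) \<omega> :: real)" for \<omega>
  have X2: "(X \<omega>)\<^sup>2 = (\<Sum>i\<in>I. \<Sum>j\<in>I. indicator (A i \<inter> A j) \<omega>)" for \<omega>
    by (simp add: X_def power2_eq_square sum_product indicator_inter_arith)
  have "has_bochner_integral M X (\<Sum>i\<in>I. prob (A i))"
    unfolding X_def using assms
    by (intro has_bochner_integral_sum has_bochner_integral_real_indicator) (auto simp: less_top[symmetric])
  then have int_X: "integrable M X" "(\<integral>\<omega>. X \<omega> \<partial>M) = (\<Sum>i\<in>I. prob (A i))"
    by (simp_all add: has_bochner_integral_iff)
  have "has_bochner_integral M (\<lambda>\<omega>. (X \<omega>)\<^sup>2) (\<Sum>i\<in>I. \<Sum>j\<in>I. prob (A i \<inter> A j))"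
    unfolding X2 using assms
    by (intro has_bochner_integral_sum has_bochner_integral_real_indicator) (auto simp: less_top[symmetric])
  then have int_X2: "integrable M (\<lambda>\<omega>. (X \<omega>)\<^sup>2)"
    "(\<integral>\<omega>. (X \<omega>)\<^sup>2 \<partial>M) = (\<Sum>i\<in>I. \<Sum>j\<in>I. prob (A i \<inter> A j))"
    by (simp_all add: has_bochner_integral_iff)
  have U: "(\<Union>i\<in>I. A i) \<in> events" using assms by auto
  have le: "2 * t * X \<omega> - t\<^sup>2 * (X \<omega>)\<^sup>2 \<le> indicator (\<Union>i\<in>I. A i) \<omega>" for \<omega>
  proof (cases "\<omega> \<in> (\<Union>i\<in>I. A i)")
    case True
    have "0 \<le> (1 - t * X \<omega>)\<^sup>2" by simp
    then show ?thesis using True by (simp add: power2_eq_square algebra_simps)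
  next
    case False
    then have "X \<omega> = 0" by (auto simp: X_def intro!: sum.neutral)
    then show ?thesis by simp
  qed
  have "(\<integral>\<omega>. 2 * t * X \<omega> - t\<^sup>2 * (X \<omega>)\<^sup>2 \<partial>M) \<le> (\<integral>\<omega>. indicator (\<Union>i\<in>I. A i) \<omega> \<partial>M)"
    using int_X int_X2 U by (intro integral_mono le) (auto simp: integrable_indicator_iff less_top[symmetric])
  then show ?thesis using int_X int_X2 U by (simp add: sets.Int_space_eq2)
qed

end

text \<open>That \<open>w\<close> does not mention the position \<open>a\<close> stands in for shift
  invariance; that one \<open>D\<close> serves every event off the window stands in for
  mixing.\<close>

locale quasi_product = prob_space P for P :: "(int \<Rightarrow> 'a::finite) measure" +
  fixes w :: "nat \<Rightarrow> (int \<Rightarrow> 'a) \<Rightarrow> real" and D :: real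
  assumes sets_P: "sets P = sets Omega"
    and D_ge_1: "1 \<le> D"
    and w_pos: "0 < w k \<eta>"
    and sum_w: "(\<Sum>\<eta>\<in>configs (block k). w k \<eta>) = 1"
    and cylinder_le: "\<lbrakk>\<eta> \<in> configs (block k); 0 < k; finite V; V \<inter> translate a (block k) = {};
        depends_on V E\<rbrakk> \<Longrightarrow> prob ({\<sigma>. word a k \<sigma> = \<eta>} \<inter> E) \<le> D * w k \<eta> * prob E"
    and cylinder_ge: "\<lbrakk>\<eta> \<in> configs (block k); 0 < k; finite V; V \<inter> translate a (block k) = {};
        depends_on V E\<rbrakk> \<Longrightarrow> w k \<eta> * prob E \<le> D * prob ({\<sigma>. word a k \<sigma> = \<eta>} \<inter> E)"
begin

lemma space_P [simp]: "space P = UNIV"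
  using sets_eq_imp_space_eq[OF sets_P] by simp

lemma eventsI: "finite V \<Longrightarrow> depends_on V E \<Longrightarrow> E \<in> events"
  using coord_algebra_if_depends_on[of V E V] sets_coord_algebra_subset[of V] sets_P by blast

lemma word_events [simp]: "{\<sigma>. Q (word a k \<sigma>)} \<in> events"
  by (rule eventsI[OF _ depends_on_word]) simp

lemma matches_events [simp]: "matches a b k \<in> events"
  by (rule eventsI[OF _ depends_on_matches]) simp

lemma prob_UNIV [simp]: "prob UNIV = 1"
  using prob_space by simp

lemma depends_on_UNIV [simp]: "depends_on V UNIV"
  by (simp add: depends_on_def)

text \<open>The probability that two independent words with distribution \<open>w k\<close>
  coincide.\<close>

definition collision :: "nat \<Rightarrow> real" where
  "collision k = (\<Sum>\<eta>\<in>configs (block k). (w k \<eta>)\<^sup>2)"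

lemma collision_pos: "0 < collision k"
  unfolding collision_def by (intro sum_pos finite_configs zero_less_power w_pos) auto

lemma w_le_sqrt_collision: "\<eta> \<in> configs (block k) \<Longrightarrow> w k \<eta> \<le> sqrt (collision k)"
  unfolding collision_def
  by (intro real_le_rsqrt member_le_sum finite_configs) auto

lemma prob_word_le: "\<eta> \<in> configs (block k) \<Longrightarrow> 0 < k \<Longrightarrow> prob {\<sigma>. word a k \<sigma> = \<eta>} \<le> D * w k \<eta>"
  using cylinder_le[of \<eta> k "{}" a UNIV] by simp

lemma prob_word_ge: "\<eta> \<in> configs (block k) \<Longrightarrow> 0 < k \<Longrightarrow> w k \<eta> \<le> D * prob {\<sigma>. word a k \<sigma> = \<eta>}"
  using cylinder_ge[of \<eta> k "{}" a UNIV] by simp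

lemma prob_eq_sum_words:
  assumes "E \<in> events"
  shows "prob E = (\<Sum>\<eta>\<in>configs (block k). prob ({\<sigma>. word a k \<sigma> = \<eta>} \<inter> E))"
proof -
  have "E = (\<Union>\<eta>\<in>configs (block k). {\<sigma>. word a k \<sigma> = \<eta>} \<inter> E)" by auto
  then have "prob E = prob (\<Union>\<eta>\<in>configs (block k). {\<sigma>. word a k \<sigma> = \<eta>} \<inter> E)" by simp
  also have "\<dots> = (\<Sum>\<eta>\<in>configs (block k). prob ({\<sigma>. word a k \<sigma> = \<eta>} \<inter> E))"
  proof (rule finite_measure_finite_Union)
    show "(\<lambda>\<eta>. {\<sigma>. word a k \<sigma> = \<eta>} \<inter> E) ` configs (block k) \<subseteq> events"
      using assms word_events[of "\<lambda>x. x = _"] by auto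
  qed (auto simp: disjoint_family_on_def intro: finite_configs)
  finally show ?thesis .
qed

text \<open>The windows are removed one at a time; while the first is removed, the second counts as
  part of the outside event.\<close>

lemma two_words_le:
  assumes "\<eta> \<in> configs (block k)" "0 < k" "finite V" "depends_on V E"
    and "V \<inter> translate a (block k) = {}" "V \<inter> translate b (block k) = {}"
    and "translate a (block k) \<inter> translate b (block k) = {}"
  shows "prob ({\<sigma>. word a k \<sigma> = \<eta>} \<inter> ({\<sigma>. word b k \<sigma> = \<eta>} \<inter> E)) \<le> D\<^sup>2 * (w k \<eta>)\<^sup>2 * prob E"
proof -
  have "prob ({\<sigma>. word a k \<sigma> = \<eta>} \<inter> ({\<sigma>. word b k \<sigma> = \<eta>} \<inter> E))
      \<le> D * w k \<eta> * prob ({\<sigma>. word b k \<sigma> = \<eta>} \<inter> E)"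
  proof (rule cylinder_le[where V = "translate b (block k) \<union> V"])
    show "depends_on (translate b (block k) \<union> V) ({\<sigma>. word b k \<sigma> = \<eta>} \<inter> E)"
      by (intro depends_on_Int depends_on_mono[OF depends_on_word] depends_on_mono[OF assms(4)]) auto
  qed (use assms in auto)
  also have "\<dots> \<le> D * w k \<eta> * (D * w k \<eta> * prob E)"
    using assms D_ge_1 w_pos[of k \<eta>] by (intro mult_left_mono cylinder_le[of _ _ V]) auto
  finally show ?thesis by (simp add: power2_eq_square algebra_simps)
qed

text \<open>Summation over the common word. The event \<open>E\<close> is kept so that it can itself
  be a match between two further windows.\<close>

lemma matches_Int_le:
  assumes "0 < k" "finite V" "depends_on V E"
    and "V \<inter> translate a (block k) = {}" "V \<inter> translate b (block k) = {}"
    and "translate a (block k) \<inter> translate b (block k) = {}"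
  shows "prob (matches a b k \<inter> E) \<le> D\<^sup>2 * collision k * prob E"
proof -
  have "prob (matches a b k \<inter> E) =
      (\<Sum>\<eta>\<in>configs (block k). prob ({\<sigma>. word a k \<sigma> = \<eta>} \<inter> (matches a b k \<inter> E)))"
    by (rule prob_eq_sum_words) (simp add: sets.Int eventsI[OF assms(2,3)])
  also have "\<dots> = (\<Sum>\<eta>\<in>configs (block k). prob ({\<sigma>. word a k \<sigma> = \<eta>} \<inter> ({\<sigma>. word b k \<sigma> = \<eta>} \<inter> E)))"
    by (intro sum.cong refl arg_cong[where f = prob]) (auto simp: matches_def)
  also have "\<dots> \<le> (\<Sum>\<eta>\<in>configs (block k). D\<^sup>2 * (w k \<eta>)\<^sup>2 * prob E)"
    using assms by (intro sum_mono two_words_le) auto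
  also have "\<dots> = D\<^sup>2 * collision k * prob E"
    by (simp add: collision_def sum_distrib_left sum_distrib_right mult.assoc)
  finally show ?thesis .
qed

lemma matches_le:
  assumes "0 < k" "translate a (block k) \<inter> translate b (block k) = {}"
  shows "prob (matches a b k) \<le> D\<^sup>2 * collision k"
  using matches_Int_le[of k "{}" UNIV a b] assms by simp

lemma matches_ge:
  assumes "0 < k" "translate a (block k) \<inter> translate b (block k) = {}"
  shows "collision k \<le> D\<^sup>2 * prob (matches a b k)"
proof -
  have D: "0 \<le> D" using D_ge_1 by simp
  have "collision k \<le> (\<Sum>\<eta>\<in>configs (block k). D\<^sup>2 * prob ({\<sigma>. word a k \<sigma> = \<eta>} \<inter> matches a b k))"
    unfolding collision_def
  proof (rule sum_mono)
    fix \<eta> :: "int \<Rightarrow> 'a" assume \<eta>: "\<eta> \<in> configs (block k)"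
    have "(w k \<eta>)\<^sup>2 \<le> w k \<eta> * (D * prob {\<sigma>. word b k \<sigma> = \<eta>})"
      unfolding power2_eq_square using \<eta> assms w_pos[of k \<eta>]
      by (intro mult_left_mono prob_word_ge) auto
    also have "\<dots> = D * (w k \<eta> * prob {\<sigma>. word b k \<sigma> = \<eta>})" by simp
    also have "\<dots> \<le> D * (D * prob ({\<sigma>. word a k \<sigma> = \<eta>} \<inter> {\<sigma>. word b k \<sigma> = \<eta>}))"
      using \<eta> assms D
      by (intro mult_left_mono cylinder_ge[of _ _ "translate b (block k)"] depends_on_word) auto
    also have "{\<sigma>. word a k \<sigma> = \<eta>} \<inter> {\<sigma>. word b k \<sigma> = \<eta>} = {\<sigma>. word a k \<sigma> = \<eta>} \<inter> matches a b k"
      by (auto simp: matches_def)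
    finally show "(w k \<eta>)\<^sup>2 \<le> D\<^sup>2 * prob ({\<sigma>. word a k \<sigma> = \<eta>} \<inter> matches a b k)"
      by (simp add: power2_eq_square mult.assoc)
  qed
  also have "\<dots> = D\<^sup>2 * prob (matches a b k)"
    by (simp add: sum_distrib_left[symmetric] prob_eq_sum_words[symmetric])
  finally show ?thesis .
qed

text \<open>Three windows carrying one word would give the sum of the cubes of \<open>w\<close>; one
  factor is replaced by its maximum, which leaves \<open>sqrt (collision k)\<close> times the sum of
  the squares.\<close>

lemma matches_common_block_le:
  assumes "0 < k" "translate a (block k) \<inter> translate b (block k) = {}"
    and "translate a (block k) \<inter> translate b' (block k) = {}"
    and "translate b (block k) \<inter> translate b' (block k) = {}"
  shows "prob (matches a b k \<inter> matches a b' k) \<le> D\<^sup>2 * collision k * (D * sqrt (collision k))"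
proof -
  have "prob (matches a b k \<inter> matches a b' k) = (\<Sum>\<eta>\<in>configs (block k).
      prob ({\<sigma>. word b' k \<sigma> = \<eta>} \<inter> (matches a b k \<inter> matches a b' k)))"
    by (rule prob_eq_sum_words) (simp add: sets.Int)
  \<comment> \<open>Once the word at \<open>b'\<close> is fixed, matching it says that the word at
    \<open>a\<close> is the same fixed word; the remaining event no longer involves
    \<open>b'\<close>.\<close>
  also have "\<dots> = (\<Sum>\<eta>\<in>configs (block k).
      prob ({\<sigma>. word b' k \<sigma> = \<eta>} \<inter> ({\<sigma>. word a k \<sigma> = \<eta>} \<inter> matches a b k)))"
    by (intro sum.cong refl arg_cong[where f = prob]) (auto simp: matches_def)
  also have "\<dots> \<le> (\<Sum>\<eta>\<in>configs (block k).
      D * sqrt (collision k) * prob ({\<sigma>. word a k \<sigma> = \<eta>} \<inter> matches a b k))"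
  proof (rule sum_mono)
    fix \<eta> :: "int \<Rightarrow> 'a" assume \<eta>: "\<eta> \<in> configs (block k)"
    have "prob ({\<sigma>. word b' k \<sigma> = \<eta>} \<inter> ({\<sigma>. word a k \<sigma> = \<eta>} \<inter> matches a b k))
       \<le> D * w k \<eta> * prob ({\<sigma>. word a k \<sigma> = \<eta>} \<inter> matches a b k)"
    proof (rule cylinder_le[OF \<eta> \<open>0 < k\<close>])
      show "depends_on (translate a (block k) \<union> translate b (block k))
          ({\<sigma>. word a k \<sigma> = \<eta>} \<inter> matches a b k)"
        by (intro depends_on_Int depends_on_mono[OF depends_on_word] depends_on_matches) auto
    qed (use assms in auto)
    also have "\<dots> \<le> D * sqrt (collision k) * prob ({\<sigma>. word a k \<sigma> = \<eta>} \<inter> matches a b k)"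
      using D_ge_1 \<eta> by (intro mult_right_mono mult_left_mono w_le_sqrt_collision) auto
    finally show "prob ({\<sigma>. word b' k \<sigma> = \<eta>} \<inter> ({\<sigma>. word a k \<sigma> = \<eta>} \<inter> matches a b k))
       \<le> D * sqrt (collision k) * prob ({\<sigma>. word a k \<sigma> = \<eta>} \<inter> matches a b k)" .
  qed
  also have "\<dots> = D * sqrt (collision k) * prob (matches a b k)"
    by (simp add: sum_distrib_left[symmetric] prob_eq_sum_words[symmetric])
  also have "\<dots> \<le> D * sqrt (collision k) * (D\<^sup>2 * collision k)"
    using D_ge_1 collision_pos[of k] assms by (intro mult_left_mono matches_le) auto
  finally show ?thesis by (simp add: mult_ac)
qed

text \<open>If the two windows overlap, the word in \<open>(a, b]\<close> determines the word in the second window.\<close>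

lemma overlapping_matches_le:
  assumes "0 < k" "0 < d"
  shows "prob (matches a (a + int d) k) \<le> D * sqrt (collision k)"
proof -
  define b where "b = a + int d"
  have determined: "word b k \<sigma> = word b k \<sigma>'"
    if m: "\<sigma> \<in> matches a b k" "\<sigma>' \<in> matches a b k" and eq: "word a d \<sigma> = word a d \<sigma>'" for \<sigma> \<sigma>'
  proof -
    \<comment> \<open>Sites are determined from left to right: the first \<open>d\<close> by the
      given word, and each later one as a copy of the site \<open>d\<close> places before
      it.\<close>
    have "\<sigma> (a + int x) = \<sigma>' (a + int x)" if "1 \<le> x" "x \<le> d + k" for x
      using that
    proof (induction x rule: less_induct)
      case (less x)
      show ?case
      proof (cases "x \<le> d")
        case True
        with eq less.prems show ?thesis by (auto simp: word_eq_iff block_def)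
      next
        case False
        have "int (x - d) \<in> block k" using False less.prems by (auto simp: block_def)
        with m have "\<sigma> (a + int (x - d)) = \<sigma> (b + int (x - d))" "\<sigma>' (a + int (x - d)) = \<sigma>' (b + int (x - d))"
          unfolding matches_def mem_Collect_eq word_eq_iff by blast+
        moreover have "\<sigma> (a + int (x - d)) = \<sigma>' (a + int (x - d))"
          using False less.prems \<open>0 < d\<close> by (intro less.IH) auto
        moreover have "b + int (x - d) = a + int x" using False by (simp add: b_def)
        ultimately show ?thesis by simp
      qed
    qed
    note eq_upto = this
    have "\<sigma> (b + i) = \<sigma>' (b + i)" if "i \<in> block k" for i
    proof -
      have "b + i = a + int (d + nat i)" "1 \<le> d + nat i" "d + nat i \<le> d + k"
        using that by (auto simp: b_def block_def)
      with eq_upto[of "d + nat i"] show ?thesis by simp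
    qed
    then show ?thesis by (simp add: word_eq_iff)
  qed
  \<comment> \<open>If no matching configuration starts with the given word, the value is an
    arbitrary word. It still lies in \<open>configs (block k)\<close>, and the event to be bounded
    is then empty.\<close>
  define f where "f \<xi> = word b k (SOME \<sigma>. \<sigma> \<in> matches a b k \<and> word a d \<sigma> = \<xi>)"
    for \<xi> :: "int \<Rightarrow> 'a"
  have f: "word b k \<sigma> = f (word a d \<sigma>)" if "\<sigma> \<in> matches a b k" for \<sigma>
  proof -
    have "(SOME \<sigma>'. \<sigma>' \<in> matches a b k \<and> word a d \<sigma>' = word a d \<sigma>) \<in> matches a b k \<and>
        word a d (SOME \<sigma>'. \<sigma>' \<in> matches a b k \<and> word a d \<sigma>' = word a d \<sigma>) = word a d \<sigma>"
      using that by (intro someI[where P = "\<lambda>\<sigma>'. \<sigma>' \<in> matches a b k \<and> word a d \<sigma>' = word a d \<sigma>"]) simp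
    then show ?thesis unfolding f_def using that by (intro determined) auto
  qed
  have f_configs: "f \<xi> \<in> configs (block k)" for \<xi> by (simp add: f_def)
  have "prob (matches a b k) = (\<Sum>\<xi>\<in>configs (block d). prob ({\<sigma>. word a d \<sigma> = \<xi>} \<inter> matches a b k))"
    by (rule prob_eq_sum_words) simp
  also have "\<dots> \<le> (\<Sum>\<xi>\<in>configs (block d). D * sqrt (collision k) * prob {\<sigma>. word a d \<sigma> = \<xi>})"
  proof (rule sum_mono)
    fix \<xi> :: "int \<Rightarrow> 'a" assume \<xi>: "\<xi> \<in> configs (block d)"
    have "prob ({\<sigma>. word a d \<sigma> = \<xi>} \<inter> matches a b k)
        \<le> prob ({\<sigma>. word b k \<sigma> = f \<xi>} \<inter> {\<sigma>. word a d \<sigma> = \<xi>})"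
    proof (rule finite_measure_mono)
      show "{\<sigma>. word b k \<sigma> = f \<xi>} \<inter> {\<sigma>. word a d \<sigma> = \<xi>} \<in> events"
        by (intro sets.Int word_events)
    qed (auto simp: f)
    also have "\<dots> \<le> D * w k (f \<xi>) * prob {\<sigma>. word a d \<sigma> = \<xi>}"
      using assms f_configs
      by (intro cylinder_le[of _ _ "translate a (block d)"] depends_on_word translate_block_disjoint)
        (auto simp: b_def)
    also have "\<dots> \<le> D * sqrt (collision k) * prob {\<sigma>. word a d \<sigma> = \<xi>}"
      using D_ge_1 f_configs by (intro mult_right_mono mult_left_mono w_le_sqrt_collision) auto
    finally show "prob ({\<sigma>. word a d \<sigma> = \<xi>} \<inter> matches a b k)
        \<le> D * sqrt (collision k) * prob {\<sigma>. word a d \<sigma> = \<xi>}" .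
  qed
  also have "\<dots> = D * sqrt (collision k)"
    using prob_eq_sum_words[of UNIV a d] eventsI[of "{}" UNIV]
    by (simp add: sum_distrib_left[symmetric])
  finally show ?thesis by (simp add: b_def)
qed

text \<open>Among \<open>2 * r\<close> adjacent windows only pairs with one window in each half are
  used. Then a first window is never the second window of another pair, and two pairs share a first
  window, a second window, both or neither. The hypothesis makes the expected number of matches at
  least of constant order.\<close>

lemma block_matches_ge:
  fixes r k :: nat
  assumes "0 < k" "1 \<le> (real r)\<^sup>2 * collision k"
  shows "1 / (4 * D ^ 8) \<le> prob (\<Union>(i, j)\<in>{..<r} \<times> {r..<2 * r}.
    matches (a + int (i * k)) (a + int (j * k)) k)"
proof -
  define pos where "pos i = a + int (i * k)" for i
  define A :: "nat \<times> nat \<Rightarrow> (int \<Rightarrow> 'a) set" where "A = (\<lambda>(i, j). matches (pos i) (pos j) k)"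
  define I where "I = {..<r} \<times> {r..<2 * r}"
  define z where "z = sqrt (collision k)"
  \<comment> \<open>A common bound for all four cases: equal indices gain the extra
    \<open>z\<close>. Its product form lets the fourfold sum over two pairs factorise into one
    double sum for each half.\<close>
  define \<phi> where "\<phi> i i' = z\<^sup>2 + (if i = i' then z else 0)" for i i' :: nat
  define q where "q = (real r)\<^sup>2 * z\<^sup>2"
  have z: "0 < z" "collision k = z\<^sup>2" using collision_pos[of k] by (auto simp: z_def)
  have q: "1 \<le> q" using assms z by (simp add: q_def)
  have disj: "translate (pos i) (block k) \<inter> translate (pos j) (block k) = {}" if "i \<noteq> j" for i j
  proof -
    have *: "translate (pos i) (block k) \<inter> translate (pos j) (block k) = {}" if "i < j" for i j
    proof (rule translate_block_disjoint)
      have "i * k + k \<le> j * k" using that by (metis Suc_leI mult_Suc mult_le_mono1 add.commute)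
      then show "pos i + int k \<le> pos j" by (simp add: pos_def flip: of_nat_add of_nat_mult)
    qed
    show ?thesis using *[of i j] *[of j i] that by (cases "i < j") auto
  qed
  have D_pow: "D ^ m \<le> D ^ n" if "m \<le> n" for m n
    using D_ge_1 that by (rule power_increasing[rotated])
  have D0: "0 < D" using D_ge_1 by simp
  have pair: "prob (A (i, j) \<inter> A (i', j')) \<le> D ^ 4 * (\<phi> i i' * \<phi> j j')"
    if "i < r" "i' < r" "r \<le> j" "r \<le> j'" for i i' j j'
  proof -
    have ne: "i \<noteq> j" "i \<noteq> j'" "i' \<noteq> j" "i' \<noteq> j'" using that by auto
    consider "i \<noteq> i'" "j \<noteq> j'" | "i = i'" "j \<noteq> j'" | "i \<noteq> i'" "j = j'" | "i = i'" "j = j'" by blast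
    then show ?thesis
    proof cases
      case 1
      have "prob (A (i, j) \<inter> A (i', j')) \<le> D\<^sup>2 * z\<^sup>2 * prob (A (i', j'))"
        unfolding A_def z(2)[symmetric] using assms(1) ne 1 disj
        by (auto intro!: matches_Int_le[OF _ _ depends_on_matches] simp: Int_Un_distrib2)
      also have "\<dots> \<le> D\<^sup>2 * z\<^sup>2 * (D\<^sup>2 * z\<^sup>2)"
        unfolding A_def z(2)[symmetric] using assms(1) ne collision_pos[of k] disj
        by (auto intro!: mult_left_mono matches_le)
      also have "\<dots> = D ^ 4 * (z\<^sup>2 * z\<^sup>2)" by (simp add: power2_eq_square power4_eq_xxxx algebra_simps)
      finally show ?thesis using 1 by (simp add: \<phi>_def)
    next
      case 2
      have "prob (A (i, j) \<inter> A (i', j')) \<le> D\<^sup>2 * z\<^sup>2 * (D * z)"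
        using matches_common_block_le[of k "pos i" "pos j" "pos j'"] assms(1) ne 2 disj z(1)
        unfolding z_def[symmetric] z(2) by (simp add: A_def)
      also have "\<dots> = D ^ 3 * (z * z\<^sup>2)" by (simp add: power2_eq_square power3_eq_cube algebra_simps)
      also have "\<dots> \<le> D ^ 4 * ((z\<^sup>2 + z) * z\<^sup>2)"
        using z D_ge_1 by (intro mult_mono D_pow) auto
      finally show ?thesis using 2 by (simp add: \<phi>_def)
    next
      case 3
      have "prob (A (i, j) \<inter> A (i', j')) \<le> D\<^sup>2 * z\<^sup>2 * (D * z)"
        using matches_common_block_le[of k "pos j" "pos i" "pos i'"] assms(1) ne 3 disj z(1)
        unfolding z_def[symmetric] z(2) by (simp add: A_def matches_commute[of "pos j'"])
      also have "\<dots> = D ^ 3 * (z\<^sup>2 * z)" by (simp add: power2_eq_square power3_eq_cube algebra_simps)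
      also have "\<dots> \<le> D ^ 4 * (z\<^sup>2 * (z\<^sup>2 + z))"
        using z D_ge_1 by (intro mult_mono D_pow) auto
      finally show ?thesis using 3 by (simp add: \<phi>_def)
    next
      case 4
      have "prob (A (i, j) \<inter> A (i', j')) \<le> D\<^sup>2 * z\<^sup>2"
        using matches_le[of k "pos i" "pos j"] assms(1) ne 4 disj
        by (simp add: A_def z)
      also have "\<dots> \<le> D ^ 4 * ((z\<^sup>2 + z) * (z\<^sup>2 + z))"
        unfolding power2_eq_square[of z] using z(1) D_ge_1
        by (intro mult_mono D_pow) auto
      finally show ?thesis using 4 by (simp add: \<phi>_def)
    qed
  qed
  have \<phi>_sum: "(\<Sum>i\<in>J. \<Sum>i'\<in>J. \<phi> i i') \<le> 2 * q" if "finite J" "card J = r" for J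
  proof -
    have "(\<Sum>i\<in>J. \<Sum>i'\<in>J. \<phi> i i') = (real r)\<^sup>2 * z\<^sup>2 + real r * z"
      using that by (simp add: \<phi>_def sum.distrib power2_eq_square distrib_left)
    \<comment> \<open>The diagonal contributes \<open>r * z\<close>; since \<open>r * z\<close> is
      at least 1, this is at most its square \<open>q\<close>.\<close>
    also have "(real r * z) * 1 \<le> (real r * z) * (real r * z)"
    proof (rule mult_left_mono)
      have "1\<^sup>2 \<le> (real r * z)\<^sup>2" using q by (simp add: q_def power_mult_distrib)
      then show "1 \<le> real r * z" by (rule power2_le_imp_le) (use z in simp)
    qed (use z in simp)
    then have "(real r)\<^sup>2 * z\<^sup>2 + real r * z \<le> 2 * q" by (simp add: q_def power2_eq_square algebra_simps)
    finally show ?thesis .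
  qed
  have \<phi>_nonneg: "0 \<le> \<phi> i i'" for i i' using z by (simp add: \<phi>_def)
  have "(\<Sum>x\<in>I. \<Sum>y\<in>I. prob (A x \<inter> A y)) \<le> (\<Sum>x\<in>I. \<Sum>y\<in>I. D ^ 4 * (\<phi> (fst x) (fst y) * \<phi> (snd x) (snd y)))"
    by (intro sum_mono) (auto simp: I_def intro!: pair)
  also have "\<dots> = D ^ 4 * ((\<Sum>i<r. \<Sum>i'<r. \<phi> i i') * (\<Sum>j=r..<2*r. \<Sum>j'=r..<2*r. \<phi> j j'))"
  proof -
    have "(\<Sum>x\<in>I. \<Sum>y\<in>I. \<phi> (fst x) (fst y) * \<phi> (snd x) (snd y)) =
      (\<Sum>i<r. \<Sum>j=r..<2*r. \<Sum>i'<r. \<Sum>j'=r..<2*r. \<phi> i i' * \<phi> j j')"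
      unfolding I_def by (simp add: sum.cartesian_product')
    also have "\<dots> = (\<Sum>i<r. \<Sum>j=r..<2*r. (\<Sum>i'<r. \<phi> i i') * (\<Sum>j'=r..<2*r. \<phi> j j'))"
      by (simp add: sum_product)
    also have "\<dots> = (\<Sum>i<r. \<Sum>i'<r. \<phi> i i') * (\<Sum>j=r..<2*r. \<Sum>j'=r..<2*r. \<phi> j j')"
      by (rule sum_product[symmetric])
    finally show ?thesis by (simp add: sum_distrib_left[symmetric])
  qed
  also have "\<dots> \<le> D ^ 4 * ((2 * q) * (2 * q))"
    using q D0 by (intro mult_left_mono mult_mono \<phi>_sum sum_nonneg \<phi>_nonneg) auto
  finally have second: "(\<Sum>x\<in>I. \<Sum>y\<in>I. prob (A x \<inter> A y)) \<le> 4 * D ^ 4 * q\<^sup>2"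
    by (simp add: power2_eq_square algebra_simps)
  have "(\<Sum>x\<in>I. z\<^sup>2 / D\<^sup>2) \<le> (\<Sum>x\<in>I. prob (A x))"
  proof (rule sum_mono)
    fix x assume "x \<in> I"
    then obtain i j where x: "x = (i, j)" "i < r" "r \<le> j" by (auto simp: I_def)
    then show "z\<^sup>2 / D\<^sup>2 \<le> prob (A x)"
      using matches_ge[of k "pos i" "pos j"] assms(1) disj[of i j] D0
      by (simp add: A_def z field_simps)
  qed
  then have first: "q / D\<^sup>2 \<le> (\<Sum>x\<in>I. prob (A x))"
    by (simp add: I_def q_def power2_eq_square)
  \<comment> \<open>The maximiser of 2 t x - t^2 y for the moment bounds x = q / D^2 and y = 4 D^4
    q^2; the maximum x^2 / y no longer contains \<open>q\<close>.\<close>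
  define t where "t = 1 / (4 * D ^ 6 * q)"
  have t: "0 \<le> t" using q D0 by (simp add: t_def)
  have "1 / (4 * D ^ 8) = 2 * t * (q / D\<^sup>2) - t\<^sup>2 * (4 * D ^ 4 * q\<^sup>2)"
  proof -
    have "2 * t * (q / D\<^sup>2) = 2 / (4 * D ^ 8)"
      using q D0 by (simp add: t_def field_simps flip: power_add)
    moreover have "t\<^sup>2 * (4 * D ^ 4 * q\<^sup>2) = 1 / (4 * D ^ 8)"
      using q D0 by (simp add: t_def power2_eq_square field_simps flip: power_add)
    ultimately show ?thesis by simp
  qed
  also have "\<dots> \<le> 2 * t * (\<Sum>x\<in>I. prob (A x)) - t\<^sup>2 * (\<Sum>x\<in>I. \<Sum>y\<in>I. prob (A x \<inter> A y))"
    using t first second by (intro diff_mono mult_left_mono) auto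
  also have "\<dots> \<le> prob (\<Union>x\<in>I. A x)"
    by (rule prob_Union_ge_second_moment) (auto simp: I_def A_def)
  finally show ?thesis by (simp add: I_def A_def pos_def case_prod_beta')
qed

text \<open>The event \<open>F\<close> is a disjoint union of word cylinders of its window. One
  factor \<open>D\<close> compares the probability of a cylinder with its weight, another compares
  that weight with the conditional probability given \<open>E\<close>.\<close>

lemma quasi_independent:
  assumes F: "depends_on (translate a (block n)) F" and "0 < n"
    and V: "finite V" "V \<inter> translate a (block n) = {}" and E: "depends_on V E"
  shows "prob F * prob E \<le> D\<^sup>2 * prob (F \<inter> E)"
proof -
  have ev: "F \<in> events" "E \<in> events" using eventsI[OF _ F] eventsI[OF V(1) E] by auto
  have D0: "0 < D" using D_ge_1 by simp
  have "prob F * prob E = (\<Sum>\<eta>\<in>configs (block n). prob ({\<sigma>. word a n \<sigma> = \<eta>} \<inter> F) * prob E)"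
    using prob_eq_sum_words[OF ev(1), of a n] by (simp add: sum_distrib_right)
  also have "\<dots> \<le> (\<Sum>\<eta>\<in>configs (block n). D\<^sup>2 * prob ({\<sigma>. word a n \<sigma> = \<eta>} \<inter> (F \<inter> E)))"
  proof (rule sum_mono)
    fix \<eta> :: "int \<Rightarrow> 'a" assume \<eta>: "\<eta> \<in> configs (block n)"
    show "prob ({\<sigma>. word a n \<sigma> = \<eta>} \<inter> F) * prob E \<le> D\<^sup>2 * prob ({\<sigma>. word a n \<sigma> = \<eta>} \<inter> (F \<inter> E))"
    \<comment> \<open>Since the window determines \<open>F\<close>, a word cylinder either misses
      \<open>F\<close> or is contained in it.\<close>
    proof (cases "{\<sigma>. word a n \<sigma> = \<eta>} \<inter> F = {}")
      case False
      then obtain \<sigma> where \<sigma>: "word a n \<sigma> = \<eta>" "\<sigma> \<in> F" by blast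
      have sub: "{\<sigma>. word a n \<sigma> = \<eta>} \<subseteq> F"
      proof
        fix \<sigma>' assume "\<sigma>' \<in> {\<sigma>. word a n \<sigma> = \<eta>}"
        with \<sigma> have eq: "\<forall>i\<in>block n. \<sigma> (a + i) = \<sigma>' (a + i)" by (simp add: word_eq_iff[symmetric])
        then show "\<sigma>' \<in> F"
          using depends_onD[OF F, of \<sigma> \<sigma>'] \<sigma>(2) by (force simp: translate_def add.commute)
      qed
      have "prob ({\<sigma>. word a n \<sigma> = \<eta>} \<inter> F) * prob E \<le> (D * w n \<eta>) * prob E"
        using prob_word_le[OF \<eta> \<open>0 < n\<close>, of a] sub by (simp add: Int_absorb2 mult_right_mono)
      also have "\<dots> \<le> D * (D * prob ({\<sigma>. word a n \<sigma> = \<eta>} \<inter> E))"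
        using cylinder_ge[OF \<eta> \<open>0 < n\<close> V E] D0 by (simp add: mult.assoc)
      also have "{\<sigma>. word a n \<sigma> = \<eta>} \<inter> E = {\<sigma>. word a n \<sigma> = \<eta>} \<inter> (F \<inter> E)" using sub by blast
      finally show ?thesis by (simp add: power2_eq_square mult.assoc)
    qed (use D0 in simp)
  qed
  also have "\<dots> = D\<^sup>2 * prob (F \<inter> E)"
    using ev by (simp add: sum_distrib_left[symmetric] prob_eq_sum_words[symmetric] sets.Int)
  finally show ?thesis .
qed

end

subsection \<open>Longest matches of quasi-product measures\<close>

lemma max_matching_geI:
  assumes "k \<in> matching_lengths \<sigma> n" shows "k \<le> max_matching \<sigma> n"
proof -
  have "finite (matching_lengths \<sigma> n)"
    by (rule finite_subset[of _ "{..n}"]) (auto simp: matching_lengths_def)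
  with assms show ?thesis by (auto simp: max_matching_def intro: Max_ge)
qed

lemma matching_lengthsI:
  assumes "0 < k" "\<sigma> \<in> matches i j k" "0 \<le> i" "i < j" "j + int k \<le> int n"
  shows "k \<in> matching_lengths \<sigma> n"
proof -
  have "restrict (shift i \<sigma>) (block k) = restrict (shift j \<sigma>) (block k)"
    using assms(2) by (simp add: matches_def word_def)
  moreover have "0 \<le> i \<and> i < j \<and> j \<le> int n - int k" "1 \<le> k" "k \<le> n" using assms by auto
  ultimately show ?thesis unfolding matching_lengths_def by blast
qed

text \<open>The offsets that realise the maximal length also match on their first \<open>k\<close>
  sites. Natural numbers for offset and distance make the later index sets finite and countable at
  sight.\<close>

lemma max_matching_ge_imp_matches:
  assumes "0 < k" "k \<le> max_matching \<sigma> n"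
  shows "\<exists>i d. i < n \<and> 0 < d \<and> i + d < n \<and> \<sigma> \<in> matches (int i) (int i + int d) k"
proof -
  have ne: "matching_lengths \<sigma> n \<noteq> {}" using assms by (auto simp: max_matching_def split: if_splits)
  have "finite (matching_lengths \<sigma> n)"
    by (rule finite_subset[of _ "{..n}"]) (auto simp: matching_lengths_def)
  with ne have "max_matching \<sigma> n \<in> matching_lengths \<sigma> n" by (simp add: max_matching_def)
  then obtain i j where ij: "0 \<le> i" "i < j" "j \<le> int n - int (max_matching \<sigma> n)"
    and eq: "word i (max_matching \<sigma> n) \<sigma> = word j (max_matching \<sigma> n) \<sigma>"
    by (auto simp: matching_lengths_def word_def)
  have "block k \<subseteq> block (max_matching \<sigma> n)" using assms(2) by (auto simp: block_def)
  with eq have "\<sigma> \<in> matches i j k" by (auto simp: matches_def word_eq_iff)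
  with ij assms show ?thesis
    by (intro exI[of _ "nat i"] exI[of _ "nat (j - i)"]) auto
qed

context quasi_product
begin

text \<open>A window of length k at an offset between 0 and n - k only sees the sites 1 to
  n.\<close>

lemma max_matching_events: "{\<sigma>. Q (max_matching \<sigma> n)} \<in> events"
proof (rule eventsI[of "block n"])
  have "max_matching \<sigma> n = max_matching \<sigma>' n"
    if "\<And>i. i \<in> block n \<Longrightarrow> \<sigma> i = \<sigma>' i" for \<sigma> \<sigma>' :: "int \<Rightarrow> 'a"
  proof -
    have *: "word i k \<sigma> = word i k \<sigma>'" if "0 \<le> i" "i \<le> int n - int k" for i k
      using that unfolding word_eq_iff by (auto simp: block_def intro!: \<open>\<And>i. i \<in> block n \<Longrightarrow> \<sigma> i = \<sigma>' i\<close>)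
    have "matching_lengths \<sigma> n = matching_lengths \<sigma>' n"
      unfolding matching_lengths_def word_def[symmetric]
    proof (intro Collect_cong ex_cong1 conj_cong refl)
      fix k i j assume "0 \<le> i" "i < j" "j \<le> int n - int k"
      then show "(word i k \<sigma> = word j k \<sigma>) = (word i k \<sigma>' = word j k \<sigma>')"
        using *[of i k] *[of j k] by simp
    qed
    then show ?thesis by (simp add: max_matching_def)
  qed
  note eq = this
  show "depends_on (block n) {\<sigma> :: int \<Rightarrow> 'a. Q (max_matching \<sigma> n)}"
  proof (rule depends_onI)
    fix \<sigma> \<sigma>' :: "int \<Rightarrow> 'a"
    assume *: "\<And>i. i \<in> block n \<Longrightarrow> \<sigma> i = \<sigma>' i" and Q: "\<sigma> \<in> {\<sigma>. Q (max_matching \<sigma> n)}"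
    have "max_matching \<sigma> n = max_matching \<sigma>' n" by (rule eq) (rule *)
    with Q show "\<sigma>' \<in> {\<sigma>. Q (max_matching \<sigma> n)}" by simp
  qed
qed simp

text \<open>The pairs are split by distance. Those closer than \<open>k\<close> are fewer than
  \<open>n * k\<close> and pay \<open>sqrt (collision k)\<close> each; the others number at most
  \<open>n^2\<close> and pay \<open>collision k\<close>.\<close>

lemma prob_max_matching_ge:
  assumes "0 < k"
  shows "prob {\<sigma>. k \<le> max_matching \<sigma> n} \<le>
    D\<^sup>2 * ((real n)\<^sup>2 * collision k) + D * (real n * real k * sqrt (collision k))"
proof -
  define I where "I = {..<n} \<times> {1..<k}"
  define J where "J = {..<n} \<times> {k..<n}"
  define A :: "nat \<times> nat \<Rightarrow> (int \<Rightarrow> 'a) set"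
    where "A = (\<lambda>(i, d). matches (int i) (int i + int d) k)"
  have D0: "0 \<le> D" using D_ge_1 by simp
  have fin: "finite I" "finite J" by (auto simp: I_def J_def)
  have events: "(\<Union>x\<in>I. A x) \<in> events" "(\<Union>x\<in>J. A x) \<in> events"
    using fin by (auto simp: A_def split: prod.split)
  have "prob {\<sigma>. k \<le> max_matching \<sigma> n} \<le> prob ((\<Union>x\<in>I. A x) \<union> (\<Union>x\<in>J. A x))"
  proof (rule finite_measure_mono)
    show "{\<sigma>. k \<le> max_matching \<sigma> n} \<subseteq> (\<Union>x\<in>I. A x) \<union> (\<Union>x\<in>J. A x)"
    proof
      fix \<sigma> :: "int \<Rightarrow> 'a" assume "\<sigma> \<in> {\<sigma>. k \<le> max_matching \<sigma> n}"
      with assms obtain i d where "i < n" "0 < d" "i + d < n" "\<sigma> \<in> A (i, d)"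
        using max_matching_ge_imp_matches[of k \<sigma> n] by (auto simp: A_def)
      moreover from this have "(i, d) \<in> I \<union> J" by (auto simp: I_def J_def)
      ultimately show "\<sigma> \<in> (\<Union>x\<in>I. A x) \<union> (\<Union>x\<in>J. A x)" by blast
    qed
  qed (use events in blast)
  also have "\<dots> \<le> prob (\<Union>x\<in>I. A x) + prob (\<Union>x\<in>J. A x)"
    using events by (rule measure_Un_le)
  also have "prob (\<Union>x\<in>I. A x) \<le> (\<Sum>x\<in>I. prob (A x))"
    using fin by (intro measure_UNION_le) (auto simp: A_def split: prod.split)
  also have "\<dots> \<le> (\<Sum>x\<in>I. D * sqrt (collision k))"
    using assms by (intro sum_mono) (auto simp: A_def I_def intro!: overlapping_matches_le)
  also have "\<dots> = D * sqrt (collision k) * (real n * real (k - 1))" by (simp add: I_def)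
  also have "\<dots> \<le> D * sqrt (collision k) * (real n * real k)"
    using D0 collision_pos[of k] by (intro mult_left_mono) auto
  also have "prob (\<Union>x\<in>J. A x) \<le> (\<Sum>x\<in>J. prob (A x))"
    using fin by (intro measure_UNION_le) (auto simp: A_def split: prod.split)
  also have "\<dots> \<le> (\<Sum>x\<in>J. D\<^sup>2 * collision k)"
    using assms
    by (intro sum_mono) (auto simp: A_def J_def intro!: matches_le translate_block_disjoint)
  also have "\<dots> = D\<^sup>2 * collision k * (real n * real (n - k))" by (simp add: J_def)
  also have "\<dots> \<le> D\<^sup>2 * collision k * (real n * real n)"
    using D0 collision_pos[of k] by (intro mult_left_mono) auto
  finally show ?thesis by (simp add: power2_eq_square algebra_simps)
qed

lemma prob_max_matching_less:
  assumes "0 < k" "0 < r" "1 \<le> (real r)\<^sup>2 * collision k" "t * (2 * r * k) \<le> n"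
  shows "prob {\<sigma>. max_matching \<sigma> n < k} \<le> (1 - 1 / (4 * D ^ 10)) ^ t"
proof -
  \<comment> \<open>A stretch holds the \<open>2 * r\<close> adjacent windows of
    \<open>block_matches_ge\<close>.\<close>
  define L where "L = 2 * r * k"
  define I where "I = {..<r} \<times> {r..<2 * r}"
  define G :: "nat \<Rightarrow> (int \<Rightarrow> 'a) set" where
    "G l = (\<Union>(i, j)\<in>I. matches (int (l * L) + int (i * k)) (int (l * L) + int (j * k)) k)" for l
  define E where "E t = (\<Inter>l<t. - G l)" for t
  \<comment> \<open>The factor D^8 comes from \<open>block_matches_ge\<close>, a further D^2 from
    \<open>quasi_independent\<close>.\<close>
  define c where "c = 1 / (4 * D ^ 10)"
  have D0: "0 < D" using D_ge_1 by simp
  have L: "0 < L" using assms by (simp add: L_def)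
  have sub: "translate (int (l * L) + int (i * k)) (block k) \<subseteq> translate (int (l * L)) (block L)"
    if "i < 2 * r" for l i
  proof
    fix x assume "x \<in> translate (int (l * L) + int (i * k)) (block k)"
    then have "1 \<le> x - int (l * L) - int (i * k)" "x - int (l * L) - int (i * k) \<le> int k"
      by (auto simp: mem_translate block_def)
    moreover have "i * k + k \<le> L"
      unfolding L_def using that by (metis Suc_leI mult_Suc mult_le_mono1 add.commute)
    then have "int (i * k) + int k \<le> int L" by linarith
    moreover have "0 \<le> int (i * k)" by simp
    ultimately have "1 \<le> x - int (l * L)" "x - int (l * L) \<le> int L" by linarith+
    then show "x \<in> translate (int (l * L)) (block L)" by (simp add: mem_translate block_def)
  qed
  have dep_G: "depends_on (translate (int (l * L)) (block L)) (G l)" for l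
    unfolding G_def
  proof (rule depends_on_UN, clarify)
    fix i j assume "(i, j) \<in> I"
    then have "i < 2 * r" "j < 2 * r" by (auto simp: I_def)
    then show "depends_on (translate (int (l * L)) (block L))
        (matches (int (l * L) + int (i * k)) (int (l * L) + int (j * k)) k)"
      by (intro depends_on_mono[OF depends_on_matches] Un_least sub)
  qed
  \<comment> \<open>The first \<open>t\<close> stretches end where stretch number \<open>t\<close>
    begins, so the absence of matches so far is an event off the next window.\<close>
  have dep_E: "depends_on (block (t * L)) (E t)" for t
  proof (induction t)
    case (Suc t)
    have "depends_on (block (Suc t * L)) (- G t)"
    proof (rule depends_on_mono[OF depends_on_Compl[OF dep_G[of t]]])
      show "translate (int (t * L)) (block L) \<subseteq> block (Suc t * L)"
      proof
        fix x assume "x \<in> translate (int (t * L)) (block L)"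
        then have "int (t * L) + 1 \<le> x" "x \<le> int (Suc t * L)"
          by (auto simp: mem_translate block_def algebra_simps)
        moreover have "0 \<le> int (t * L)" by (rule of_nat_0_le_iff)
        ultimately have "1 \<le> x" "x \<le> int (Suc t * L)" by linarith+
        then show "x \<in> block (Suc t * L)" by (simp only: block_def atLeastAtMost_iff)
      qed
    qed
    moreover have "depends_on (block (Suc t * L)) (E t)"
      by (rule depends_on_mono[OF Suc]) (auto simp: block_def)
    moreover have "E (Suc t) = - G t \<inter> E t" by (auto simp: E_def less_Suc_eq)
    ultimately show ?case by (simp add: depends_on_Int)
  qed (simp add: E_def)
  have ev: "G l \<in> events" "E l \<in> events" for l
    by (rule eventsI[OF _ dep_G], simp, rule eventsI[OF _ dep_E], simp)
  have bound: "prob (E t) \<le> (1 - c) ^ t" for t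
  proof (induction t)
    case (Suc t)
    have "1 / (4 * D ^ 8) * prob (E t) \<le> prob (G t) * prob (E t)"
      unfolding G_def I_def using assms by (intro mult_right_mono block_matches_ge) auto
    also have "\<dots> \<le> D\<^sup>2 * prob (G t \<inter> E t)"
      by (rule quasi_independent[OF dep_G L _ _ dep_E]) (auto simp: mem_translate block_def)
    finally have "c * prob (E t) \<le> prob (G t \<inter> E t)"
      using D0 by (simp add: c_def field_simps flip: power_add)
    moreover have "prob (E (Suc t)) = prob (E t) - prob (G t \<inter> E t)"
    proof -
      have "E (Suc t) = E t - (G t \<inter> E t)" by (auto simp: E_def less_Suc_eq)
      then show ?thesis using ev by (simp add: finite_measure_Diff sets.Int)
    qed
    ultimately have "prob (E (Suc t)) \<le> (1 - c) * prob (E t)" by (simp add: algebra_simps)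
    also have "\<dots> \<le> (1 - c) * (1 - c) ^ t"
    proof (rule mult_left_mono[OF Suc])
      have "1 \<le> D ^ 10" using D_ge_1 by (rule one_le_power)
      then have "1 * 1 \<le> 4 * D ^ 10" by (intro mult_mono) auto
      then show "0 \<le> 1 - c" using D0 by (simp add: c_def divide_le_eq_1_pos)
    qed
    finally show ?case by simp
  qed (simp add: E_def)
  have "{\<sigma>. max_matching \<sigma> n < k} \<subseteq> E t"
  proof
    fix \<sigma> :: "int \<Rightarrow> 'a" assume small: "\<sigma> \<in> {\<sigma>. max_matching \<sigma> n < k}"
    show "\<sigma> \<in> E t"
    proof (rule ccontr)
      assume "\<sigma> \<notin> E t"
      then obtain l i j where l: "l < t" and ij: "i < r" "r \<le> j" "j < 2 * r"
        and match: "\<sigma> \<in> matches (int (l * L) + int (i * k)) (int (l * L) + int (j * k)) k"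
        by (auto simp: E_def G_def I_def)
      have "i * k < j * k" using ij assms(1) by (intro mult_strict_right_mono) auto
      moreover have "j * k + k \<le> L"
        unfolding L_def using ij by (metis Suc_leI mult_Suc mult_le_mono1 add.commute)
      moreover have "l * L + L \<le> t * L"
        using l by (metis Suc_leI mult_Suc mult_le_mono1 add.commute)
      ultimately have "i * k < j * k" "l * L + j * k + k \<le> n" using assms(4) by (auto simp: L_def)
      then have "k \<in> matching_lengths \<sigma> n"
        using assms(1) by (intro matching_lengthsI[OF _ match]) linarith+
      with max_matching_geI[of k \<sigma> n] small show False by simp
    qed
  qed
  then have "prob {\<sigma>. max_matching \<sigma> n < k} \<le> prob (E t)"
    using ev by (intro finite_measure_mono) auto
  with bound[of t] show ?thesis by (simp add: c_def)
qed

text \<open>At every site a different letter keeps conditional probability at least m / D whatever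
  happens elsewhere, so a prescribed letter has at most 1 - m / D. The sites of the word are then
  removed from the right.\<close>

lemma prob_word_exponential_decay:
  assumes "2 \<le> CARD('a)"
  shows "\<exists>\<rho>. 0 < \<rho> \<and> \<rho> < 1 \<and> (\<forall>k a. \<forall>\<eta>\<in>configs (block k). prob {\<sigma>. word a k \<sigma> = \<eta>} \<le> \<rho> ^ k)"
proof -
  define m where "m = Min (w 1 ` configs (block 1))"
  have D0: "0 < D" using D_ge_1 by simp
  have fin: "finite (configs (block 1) :: (int \<Rightarrow> 'a) set)" by (simp add: finite_configs)
  have m: "0 < m" "\<And>\<eta>. \<eta> \<in> configs (block 1) \<Longrightarrow> m \<le> w 1 \<eta>"
    unfolding m_def using fin by (auto simp: w_pos)
  have site: "prob ({\<sigma>. word a 1 \<sigma> = \<eta>} \<inter> E) \<le> (1 - m / D) * prob E"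
    if \<eta>: "\<eta> \<in> configs (block 1)" and E: "finite V" "V \<inter> translate a (block 1) = {}" "depends_on V E"
    for \<eta> a V E
  proof -
    obtain y where "y \<noteq> \<eta> 1"
      using assms by (metis (full_types) UNIV_I card_1_singleton_iff
          card_le_Suc0_iff_eq finite not_less_eq_eq numeral_2_eq_2)
    define \<eta>' where "\<eta>' = restrict (\<lambda>_. y) (block 1)"
    have ne: "\<eta>' \<noteq> \<eta>" using \<open>y \<noteq> \<eta> 1\<close> by (auto simp: \<eta>'_def block_def fun_eq_iff)
    have E_ev: "E \<in> events" using E by (intro eventsI)
    have ev: "{\<sigma>. word a 1 \<sigma> = \<xi>} \<inter> E \<in> events" for \<xi>
      using word_events[of "\<lambda>x. x = \<xi>"] E_ev by (intro sets.Int) auto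
    have "m * prob E \<le> w 1 \<eta>' * prob E"
      by (intro mult_right_mono m) (auto simp: \<eta>'_def)
    also have "\<dots> \<le> D * prob ({\<sigma>. word a 1 \<sigma> = \<eta>'} \<inter> E)"
      using E by (intro cylinder_ge[of _ _ V]) (auto simp: \<eta>'_def)
    finally have "m / D * prob E \<le> prob ({\<sigma>. word a 1 \<sigma> = \<eta>'} \<inter> E)" using D0 by (simp add: field_simps)
    moreover have "prob ({\<sigma>. word a 1 \<sigma> = \<eta>} \<inter> E) + prob ({\<sigma>. word a 1 \<sigma> = \<eta>'} \<inter> E) \<le> prob E"
      using ev E_ev ne by (subst finite_measure_Union[symmetric]) (auto intro!: finite_measure_mono)
    ultimately show ?thesis by (simp add: algebra_simps)
  qed
  \<comment> \<open>The maximum with 1/2 secures positivity without an upper bound on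
    \<open>m\<close>.\<close>
  define \<rho> where "\<rho> = max (1 - m / D) (1 / 2)"
  have \<rho>: "0 < \<rho>" "\<rho> < 1" "1 - m / D \<le> \<rho>" using m(1) D0 by (auto simp: \<rho>_def)
  have "prob {\<sigma>. word a k \<sigma> = \<eta>} \<le> \<rho> ^ k" if "\<eta> \<in> configs (block k)" for k a \<eta>
    using that
  proof (induction k arbitrary: \<eta>)
    case (Suc k)
    define E where "E = {\<sigma>. word a k \<sigma> = restrict \<eta> (block k)}"
    have "prob {\<sigma>. word a (Suc k) \<sigma> = \<eta>} \<le> prob ({\<sigma>. word (a + int k) 1 \<sigma> = word (int k) 1 \<eta>} \<inter> E)"
    proof (rule finite_measure_mono)
      show "{\<sigma>. word a (Suc k) \<sigma> = \<eta>} \<subseteq> {\<sigma>. word (a + int k) 1 \<sigma> = word (int k) 1 \<eta>} \<inter> E"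
      proof
        fix \<sigma> :: "int \<Rightarrow> 'a" assume "\<sigma> \<in> {\<sigma>. word a (Suc k) \<sigma> = \<eta>}"
        then have *: "\<sigma> (a + i) = \<eta> i" if "i \<in> block (Suc k)" for i
          using that by (simp add: word_eq_configs_iff[OF Suc.prems])
        have "\<sigma> (a + (int k + 1)) = \<eta> (int k + 1)" by (rule *) (simp add: block_def)
        moreover have "\<sigma> (a + i) = \<eta> i" if "i \<in> block k" for i
          using that by (intro *) (simp add: block_def)
        ultimately show "\<sigma> \<in> {\<sigma>. word (a + int k) 1 \<sigma> = word (int k) 1 \<eta>} \<inter> E"
          by (auto simp: E_def word_eq_configs_iff word_eq_iff block_def add.assoc)
      qed
      show "{\<sigma>. word (a + int k) 1 \<sigma> = word (int k) 1 \<eta>} \<inter> E \<in> events"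
        unfolding E_def by (intro sets.Int word_events)
    qed
    also have "\<dots> \<le> (1 - m / D) * prob E"
      unfolding E_def
      by (rule site[OF word_in_configs finite_translate_block _ depends_on_word[of a k "\<lambda>x. x = restrict \<eta> (block k)"]])
        (auto simp: mem_translate block_def)
    also have "\<dots> \<le> \<rho> * \<rho> ^ k"
      unfolding E_def using \<rho> by (intro mult_mono Suc.IH[OF restrict_in_configs]) auto
    finally show ?case by simp
  qed simp
  with \<rho> show ?thesis by blast
qed

text \<open>In each square one factor is bounded by the decaying word probability; the other factors
  sum to 1. This is the source of the positivity of the rate.\<close>

lemma collision_exponential_decay:
  assumes "2 \<le> CARD('a)"
  shows "\<exists>\<rho>. 0 < \<rho> \<and> \<rho> < 1 \<and> (\<forall>k>0. collision k \<le> D * \<rho> ^ k)"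
proof -
  obtain \<rho> where \<rho>: "0 < \<rho>" "\<rho> < 1"
    and word: "\<And>k a \<eta>. \<eta> \<in> configs (block k) \<Longrightarrow> prob {\<sigma>. word a k \<sigma> = \<eta>} \<le> \<rho> ^ k"
    using prob_word_exponential_decay[OF assms] by blast
  have "collision k \<le> D * \<rho> ^ k" if "0 < k" for k
  proof -
    have "collision k \<le> (\<Sum>\<eta>\<in>configs (block k). D * \<rho> ^ k * w k \<eta>)"
      unfolding collision_def power2_eq_square
    proof (intro sum_mono mult_right_mono)
      fix \<eta> :: "int \<Rightarrow> 'a" assume \<eta>: "\<eta> \<in> configs (block k)"
      have "w k \<eta> \<le> D * prob {\<sigma>. word 0 k \<sigma> = \<eta>}" by (rule prob_word_ge[OF \<eta> that])
      also have "\<dots> \<le> D * \<rho> ^ k" using D_ge_1 by (intro mult_left_mono word[OF \<eta>]) simp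
      finally show "w k \<eta> \<le> D * \<rho> ^ k" .
    qed (simp add: w_pos less_imp_le)
    also have "\<dots> = D * \<rho> ^ k" by (simp add: sum_distrib_left[symmetric] sum_w)
    finally show ?thesis .
  qed
  with \<rho> show ?thesis by blast
qed

end

subsection \<open>Convergence in probability\<close>

context quasi_product
begin

context
  fixes \<alpha> C :: real
  assumes card: "2 \<le> CARD('a)" and C_ge_1: "1 \<le> C"
    and collision_ge: "\<And>k. (exp (- \<alpha> * real k))\<^sup>2 \<le> C * collision k"
    and collision_le: "\<And>k. collision k \<le> C * (exp (- \<alpha> * real k))\<^sup>2"
begin

text \<open>A nonpositive rate would keep the collision probability above 1 / C for all
  lengths.\<close>

lemma rate_pos: "0 < \<alpha>"
proof (rule ccontr)
  assume "\<not> 0 < \<alpha>"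
  obtain \<rho> where \<rho>: "0 < \<rho>" "\<rho> < 1" "\<And>k. 0 < k \<Longrightarrow> collision k \<le> D * \<rho> ^ k"
    using collision_exponential_decay[OF card] by blast
  have pos: "0 < C * D" using C_ge_1 D_ge_1 by simp
  obtain k where k: "\<rho> ^ k < 1 / (C * D)"
    using real_arch_pow_inv[of "1 / (C * D)" \<rho>] \<rho>(2) pos by auto
  \<comment> \<open>The successor keeps the length positive, as the decay bound demands.\<close>
  have "1 \<le> (exp (- \<alpha> * real (Suc k)))\<^sup>2"
    using \<open>\<not> 0 < \<alpha>\<close> by (intro one_le_power) (simp add: mult_nonpos_nonneg)
  also have "\<dots> \<le> C * collision (Suc k)" by (rule collision_ge)
  also have "\<dots> \<le> C * (D * \<rho> ^ Suc k)" using C_ge_1 by (intro mult_left_mono \<rho>(3)) auto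
  also have "\<dots> \<le> C * (D * \<rho> ^ k)"
    using C_ge_1 D_ge_1 \<rho> by (intro mult_left_mono power_decreasing) auto
  also have "\<dots> < 1" using k pos by (simp add: field_simps)
  finally show False by simp
qed

lemma prob_long_matching_tendsto_0:
  assumes "1 / \<alpha> < \<beta>"
  shows "(\<lambda>n. prob {\<sigma>. nat \<lceil>\<beta> * ln (real n)\<rceil> \<le> max_matching \<sigma> n}) \<longlonglongrightarrow> 0"
proof -
  define \<delta> where "\<delta> = \<alpha> * \<beta> - 1"
  have \<delta>: "0 < \<delta>" using assms rate_pos by (simp add: \<delta>_def field_simps)
  have \<beta>: "0 < \<beta>" using assms rate_pos by (meson less_trans zero_less_divide_1_iff)
  have D0: "0 \<le> D" using D_ge_1 by simp
  \<comment> \<open>The two summands come from the disjoint and the overlapping pairs, with n exp(-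
    \<alpha> k) at most n to the power - \<delta>. The logarithm is the number of overlapping
    distances and is absorbed by that power.\<close>
  define B where "B n = D\<^sup>2 * C * (real n powr - \<delta>)\<^sup>2 +
    D * sqrt C * ((\<beta> * ln (real n) + 1) * real n powr - \<delta>)" for n
  have "(\<lambda>n. (real n powr - \<delta>)\<^sup>2) \<longlonglongrightarrow> 0" "(\<lambda>n. (\<beta> * ln (real n) + 1) * real n powr - \<delta>) \<longlonglongrightarrow> 0"
    using \<delta> \<beta> by real_asymp+
  then have "B \<longlonglongrightarrow> D\<^sup>2 * C * 0 + D * sqrt C * 0"
    unfolding B_def by (intro tendsto_intros)
  then have B: "B \<longlonglongrightarrow> 0" by simp
  show ?thesis
  proof (rule tendsto_sandwich[OF _ _ tendsto_const B])
    show "\<forall>\<^sub>F n in sequentially. prob {\<sigma>. nat \<lceil>\<beta> * ln (real n)\<rceil> \<le> max_matching \<sigma> n} \<le> B n"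
      using eventually_ge_at_top[of 2]
    proof eventually_elim
      case (elim n)
      define k where "k = nat \<lceil>\<beta> * ln (real n)\<rceil>"
      define e where "e = exp (- \<alpha> * real k)"
      have ln: "0 < \<beta> * ln (real n)" using elim \<beta> by simp
      then have k: "0 < k" "\<beta> * ln (real n) \<le> real k" "real k \<le> \<beta> * ln (real n) + 1"
        unfolding k_def by linarith+
      have "e \<le> exp (- \<alpha> * (\<beta> * ln (real n)))"
        unfolding e_def using rate_pos k(2) by simp
      then have "real n * e \<le> real n * exp (- \<alpha> * (\<beta> * ln (real n)))"
        by (intro mult_left_mono) auto
      also have "\<dots> = exp (ln (real n)) * exp (- \<alpha> * (\<beta> * ln (real n)))" using elim by simp
      also have "\<dots> = real n powr - \<delta>"
        unfolding mult_exp_exp using elim by (simp add: powr_def \<delta>_def algebra_simps)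
      finally have ne: "real n * e \<le> real n powr - \<delta>" .
      have e0: "0 < e" by (simp add: e_def)
      have "sqrt (collision k) \<le> sqrt (C * e\<^sup>2)"
        using collision_le[of k] by (simp add: e_def)
      also have "\<dots> = sqrt C * e" using e0 by (simp add: real_sqrt_mult)
      finally have sqrt_le: "sqrt (collision k) \<le> sqrt C * e" .
      have "prob {\<sigma>. k \<le> max_matching \<sigma> n} \<le>
        D\<^sup>2 * ((real n)\<^sup>2 * collision k) + D * (real n * real k * sqrt (collision k))"
        by (rule prob_max_matching_ge[OF k(1)])
      also have "\<dots> \<le> D\<^sup>2 * ((real n)\<^sup>2 * (C * e\<^sup>2)) + D * (real n * real k * (sqrt C * e))"
        using D0 sqrt_le collision_le[of k] unfolding e_def[symmetric]
        by (intro add_mono mult_left_mono) auto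
      also have "\<dots> = D\<^sup>2 * C * (real n * e)\<^sup>2 + D * sqrt C * (real k * (real n * e))"
        by (simp add: power_mult_distrib mult_ac)
      also have "\<dots> \<le> B n"
        unfolding B_def using D0 C_ge_1 ne e0 k
        by (intro add_mono mult_left_mono mult_mono power_mono) auto
      finally show ?case by (simp add: k_def)
    qed
  qed auto
qed

text \<open>With \<open>t\<close> stretches there is room for \<open>r\<close> of order n / (t log
  n), while exp(- \<alpha> k) is of order n to the power - \<alpha> \<beta>. Since \<alpha> \<beta>
  < 1, the product tends to infinity, so r^2 times the collision probability eventually exceeds 1
  for each fixed \<open>t\<close>.\<close>

lemma prob_short_matching_tendsto_0:
  assumes "0 < \<beta>" "\<beta> < 1 / \<alpha>"
  shows "(\<lambda>n. prob {\<sigma>. max_matching \<sigma> n < nat \<lceil>\<beta> * ln (real n)\<rceil>}) \<longlonglongrightarrow> 0"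
proof -
  define c where "c = 1 / (4 * D ^ 10)"
  have c: "0 < c" "c < 1"
  proof -
    have "1 \<le> D ^ 10" using D_ge_1 by (rule one_le_power)
    then have "0 < 4 * D ^ 10" "1 < 4 * D ^ 10" by linarith+
    then show "0 < c" "c < 1" by (simp_all add: c_def)
  qed
  have bound: "\<forall>\<^sub>F n in sequentially.
    prob {\<sigma>. max_matching \<sigma> n < nat \<lceil>\<beta> * ln (real n)\<rceil>} \<le> (1 - c) ^ t" if t: "0 < t" for t
  proof -
    define a where "a = \<alpha> * \<beta>"
    define T where "T = real t"
    \<comment> \<open>The factor \<open>sqrt C\<close> absorbs the constant in
      \<open>collision_ge\<close>, and exp(\<alpha>) the rounding up of \<open>k\<close>.\<close>
    define s where "s = sqrt C * exp \<alpha>"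
    have a: "0 < a" "a < 1" and T: "0 < T"
      using assms rate_pos t by (auto simp: a_def T_def field_simps)
    have "filterlim (\<lambda>n. (real n / (2 * T * (\<beta> * ln (real n) + 1)) - 1) * real n powr - a) at_top at_top"
      using a T assms(1) by real_asymp
    then have "\<forall>\<^sub>F n in sequentially. s \<le> (real n / (2 * T * (\<beta> * ln (real n) + 1)) - 1) * real n powr - a"
      by (simp add: filterlim_at_top)
    with eventually_ge_at_top[of 2] show ?thesis
    proof eventually_elim
      case (elim n)
      define k where "k = nat \<lceil>\<beta> * ln (real n)\<rceil>"
      define r where "r = n div (2 * t * k)"
      define e where "e = exp (- \<alpha> * real k)"
      \<comment> \<open>A lower bound for \<open>r\<close> free of rounding: the 1 added to the
        logarithm accounts for the ceiling, the 1 subtracted at the end for the integer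
        division.\<close>
      define y where "y = real n / (2 * T * (\<beta> * ln (real n) + 1)) - 1"
      have ln: "0 < \<beta> * ln (real n)" using elim assms(1) by simp
      then have k: "0 < k" "real k \<le> \<beta> * ln (real n) + 1"
        unfolding k_def by linarith+
      have "y \<le> real n / (2 * T * real k) - 1"
        unfolding y_def using k T by (intro diff_mono divide_left_mono mult_left_mono) auto
      also have "\<dots> \<le> real r"
      proof -
        have "0 < 2 * t * k" using k t by simp
        then have "real n < real (2 * t * k) * (real r + 1)"
          unfolding r_def
          by (metis (no_types, lifting) dividend_less_times_div mult.commute mult_Suc_right
              of_nat_Suc of_nat_less_iff of_nat_mult add.commute)
        then have "real n / real (2 * t * k) < real r + 1"
          using \<open>0 < 2 * t * k\<close> by (subst pos_divide_less_eq) (simp_all add: mult.commute)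
        then show ?thesis by (simp add: T_def)
      qed
      finally have y: "y \<le> real r" .
      have "exp (- \<alpha>) * real n powr - a = exp (- \<alpha> * (\<beta> * ln (real n) + 1))"
        using elim by (simp add: powr_def a_def mult_exp_exp algebra_simps)
      also have "\<dots> \<le> e" unfolding e_def using k(2) rate_pos by simp
      finally have e: "exp (- \<alpha>) * real n powr - a \<le> e" .
      have "sqrt C = s * exp (- \<alpha>)" by (simp add: s_def exp_minus)
      also have "\<dots> \<le> y * real n powr - a * exp (- \<alpha>)"
        using elim(2) by (intro mult_right_mono) (simp_all add: y_def)
      also have "\<dots> = y * (exp (- \<alpha>) * real n powr - a)" by simp
      also have "\<dots> \<le> real r * e" using y e by (intro mult_mono) auto
      finally have "sqrt C \<le> real r * e" .
      then have "C \<le> (real r * e)\<^sup>2" using C_ge_1 by (simp add: sqrt_le_D)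
      also have "\<dots> \<le> (real r)\<^sup>2 * (C * collision k)"
        unfolding power_mult_distrib e_def by (intro mult_left_mono collision_ge) simp
      finally have large: "1 \<le> (real r)\<^sup>2 * collision k" using C_ge_1 by simp
      have "0 < r" using large by (cases "r = 0") auto
      moreover have "t * (2 * r * k) \<le> n"
      proof -
        have "t * (2 * r * k) = r * (2 * t * k)" by simp
        also have "\<dots> \<le> n" unfolding r_def by (rule div_times_less_eq_dividend)
        finally show ?thesis .
      qed
      ultimately show ?case
        using prob_max_matching_less[OF k(1) _ large] by (simp add: k_def c_def)
    qed
  qed
  show ?thesis
  proof (rule LIMSEQ_I)
    fix \<epsilon> :: real assume "0 < \<epsilon>"
    obtain t where t: "(1 - c) ^ t < \<epsilon>"
      using real_arch_pow_inv[OF \<open>0 < \<epsilon>\<close>, of "1 - c"] c by auto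
    have "(1 - c) ^ Suc t \<le> (1 - c) ^ t" using c by (intro power_decreasing) auto
    with t have t': "(1 - c) ^ Suc t < \<epsilon>" by linarith
    from bound[of "Suc t"] obtain N where
      "\<And>n. N \<le> n \<Longrightarrow> prob {\<sigma>. max_matching \<sigma> n < nat \<lceil>\<beta> * ln (real n)\<rceil>} \<le> (1 - c) ^ Suc t"
      by (auto simp: eventually_sequentially)
    with t' show "\<exists>N. \<forall>n\<ge>N. norm (prob {\<sigma>. max_matching \<sigma> n < nat \<lceil>\<beta> * ln (real n)\<rceil>} - 0) < \<epsilon>"
      by (auto intro!: exI[of _ N] intro: order_le_less_trans)
  qed
qed

lemma max_matching_tendsto_in_prob:
  "tendsto_in_prob P (\<lambda>n \<sigma>. real (max_matching \<sigma> n) / ln (real n)) (1 / \<alpha>)"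
  unfolding tendsto_in_prob_def
proof (intro allI impI)
  fix \<epsilon> :: real assume \<epsilon>: "0 < \<epsilon>"
  define \<beta>1 where "\<beta>1 = 1 / \<alpha> + \<epsilon>"
  \<comment> \<open>The minimum keeps this threshold positive for large \<epsilon>, when 1/\<alpha>
    - \<epsilon> may be negative.\<close>
  define \<beta>2 where "\<beta>2 = 1 / \<alpha> - min \<epsilon> (1 / (2 * \<alpha>))"
  have \<beta>1: "1 / \<alpha> < \<beta>1" using \<epsilon> by (simp add: \<beta>1_def)
  have "min \<epsilon> (1 / (2 * \<alpha>)) \<le> 1 / (2 * \<alpha>)" "1 / (2 * \<alpha>) < 1 / \<alpha>"
    using rate_pos by (auto simp: field_simps)
  then have \<beta>2: "0 < \<beta>2" "\<beta>2 < 1 / \<alpha>" "1 / \<alpha> - \<epsilon> \<le> \<beta>2"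
    using \<epsilon> rate_pos by (auto simp: \<beta>2_def)
  define S where "S n = {\<omega> \<in> space P. \<bar>real (max_matching \<omega> n) / ln (real n) - 1 / \<alpha>\<bar> > \<epsilon>}" for n
  define S1 where "S1 n = {\<sigma> :: int \<Rightarrow> 'a. nat \<lceil>\<beta>1 * ln (real n)\<rceil> \<le> max_matching \<sigma> n}" for n
  define S2 where "S2 n = {\<sigma> :: int \<Rightarrow> 'a. max_matching \<sigma> n < nat \<lceil>\<beta>2 * ln (real n)\<rceil>}" for n
  have "(\<lambda>n. prob (S1 n) + prob (S2 n)) \<longlonglongrightarrow> 0 + 0"
    unfolding S1_def S2_def
    by (intro tendsto_add prob_long_matching_tendsto_0 prob_short_matching_tendsto_0 \<beta>1 \<beta>2)
  then have lim: "(\<lambda>n. prob (S1 n) + prob (S2 n)) \<longlonglongrightarrow> 0" by simp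
  have "(\<lambda>n. prob (S n)) \<longlonglongrightarrow> 0"
  proof (rule tendsto_sandwich[OF _ _ tendsto_const lim])
    show "\<forall>\<^sub>F n in sequentially. prob (S n) \<le> prob (S1 n) + prob (S2 n)"
      using eventually_ge_at_top[of 2]
    proof eventually_elim
      case (elim n)
      then have ln: "0 < ln (real n)" by simp
      have ev: "S1 n \<in> events" "S2 n \<in> events"
        unfolding S1_def S2_def by (rule max_matching_events)+
      have "S n \<subseteq> S1 n \<union> S2 n"
      proof
        fix \<sigma> assume "\<sigma> \<in> S n"
        then have "\<beta>1 < real (max_matching \<sigma> n) / ln (real n) \<or> real (max_matching \<sigma> n) / ln (real n) < \<beta>2"
          using \<beta>2(3) by (auto simp: S_def \<beta>1_def abs_if split: if_splits)
        then have "\<beta>1 * ln (real n) < real (max_matching \<sigma> n) \<or> real (max_matching \<sigma> n) < \<beta>2 * ln (real n)"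
          using ln by (simp add: field_simps)
        then show "\<sigma> \<in> S1 n \<union> S2 n"
        proof
          assume "\<beta>1 * ln (real n) < real (max_matching \<sigma> n)"
          then have "nat \<lceil>\<beta>1 * ln (real n)\<rceil> \<le> max_matching \<sigma> n" by linarith
          then show ?thesis by (simp add: S1_def)
        next
          assume "real (max_matching \<sigma> n) < \<beta>2 * ln (real n)"
          then have "max_matching \<sigma> n < nat \<lceil>\<beta>2 * ln (real n)\<rceil>" by linarith
          then show ?thesis by (simp add: S2_def)
        qed
      qed
      then have "prob (S n) \<le> prob (S1 n \<union> S2 n)" using ev by (intro finite_measure_mono) auto
      also have "\<dots> \<le> prob (S1 n) + prob (S2 n)" using ev by (rule measure_Un_le)
      finally show ?case .
    qed
  qed auto
  then show "(\<lambda>n. prob {\<omega> \<in> space P. \<epsilon> < \<bar>real (max_matching \<omega> n) / ln (real n) - 1 / \<alpha>\<bar>}) \<longlonglongrightarrow> 0"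
    by (simp add: S_def)
qed

end

end

section \<open>Gibbs measures as quasi-product measures, and their rate\<close>

context gibbs
begin

sublocale quasi_product P weight "exp (4 * crossing_bound)"
proof unfold_locales
  show "1 \<le> exp (4 * crossing_bound)" using crossing_bound_nonneg by simp
qed (use sets_P weight_pos sum_weight cylinder_bounds in auto)

text \<open>Squaring a weight doubles the energy, which turns the numerator into the partition
  function of 2U.\<close>

lemma collision_eq: "collision k = partition 2 k / (partition 1 k)\<^sup>2"
proof -
  have "(weight k \<eta>)\<^sup>2 = exp (- (2 * energy k \<eta>)) / (partition 1 k)\<^sup>2" for \<eta>
    by (simp add: weight_def power_divide exp_double[symmetric])
  then show ?thesis by (simp add: collision_def partition_def sum_divide_distrib)
qed

lemma collision_bounds:
  assumes "\<alpha> = pressure U - pressure (scale_interaction 2 U) / 2"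
  shows "(exp (- \<alpha> * real k))\<^sup>2 \<le> exp (4 * crossing_bound) * collision k"
    and "collision k \<le> exp (4 * crossing_bound) * (exp (- \<alpha> * real k))\<^sup>2"
proof -
  have "scale_interaction 1 U = U" by (simp add: scale_interaction_def)
  then have 1: "\<bar>ln (partition 1 k) - real k * pressure U\<bar> \<le> crossing_bound"
    using ln_partition_bound[of 1 k] by simp
  have 2: "\<bar>ln (partition 2 k) - real k * pressure (scale_interaction 2 U)\<bar> \<le> 2 * crossing_bound"
    using ln_partition_bound[of 2 k] by simp
  have "ln (collision k) = ln (partition 2 k) - 2 * ln (partition 1 k)"
    unfolding collision_eq using partition_pos[of 1 k] partition_pos[of 2 k]
    by (simp add: ln_div ln_realpow)
  moreover have "2 * (- \<alpha> * real k) = real k * pressure (scale_interaction 2 U) - 2 * (real k * pressure U)"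
    by (simp add: assms algebra_simps)
  \<comment> \<open>Two units of error come from the partition function at q = 2, and two from the
    squared one at q = 1. That the total agrees with the exponent in \<open>D\<close> is a
    coincidence.\<close>
  ultimately have ln: "\<bar>ln (collision k) - 2 * (- \<alpha> * real k)\<bar> \<le> 4 * crossing_bound"
    using 1 2 by linarith
  have c: "collision k = exp (ln (collision k))" using collision_pos[of k] by simp
  have e: "(exp (- \<alpha> * real k))\<^sup>2 = exp (2 * (- \<alpha> * real k))" by (rule exp_double[symmetric])
  show "(exp (- \<alpha> * real k))\<^sup>2 \<le> exp (4 * crossing_bound) * collision k"
    unfolding e by (subst c, unfold mult_exp_exp exp_le_cancel_iff) (use ln in linarith)
  show "collision k \<le> exp (4 * crossing_bound) * (exp (- \<alpha> * real k))\<^sup>2"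
    unfolding e by (subst c, unfold mult_exp_exp exp_le_cancel_iff) (use ln in linarith)
qed

end

theorem proposition4p2:
  fixes U :: "int set \<Rightarrow> (int \<Rightarrow> 'a::finite) \<Rightarrow> real"
    and P :: "(int \<Rightarrow> 'a) measure"
    and \<alpha> :: real
  assumes "CARD('a) \<ge> 2"
    and "U \<in> interactions"
    and "gibbs_measure U P"
    and "\<alpha> = pressure U - pressure (scale_interaction 2 U) / 2"
  shows "\<alpha> > 0 \<and> tendsto_in_prob P (\<lambda>n \<sigma>. real (max_matching \<sigma> n) / ln (real n)) (1 / \<alpha>)"
proof -
  interpret gibbs U P
    using assms(2,3) by unfold_locales
  have "1 \<le> exp (4 * crossing_bound)" using crossing_bound_nonneg by simp
  then show ?thesis
    using rate_pos max_matching_tendsto_in_prob assms(1) collision_bounds[OF assms(4)] by blast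
qed

end
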